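(* Let $F$ be a potential with $\mathrm{stab}(F)<\infty$ and $\mathrm{diam}(F)<\infty$ (for loss range $[0,L]$), let $\alpha\in(0,1)$ and $R>0$. Then for every arm $a^*\in[M]$, the pseudo-regret $\mathsf{Reg}_M(T)=\mathbb E\big[\sum_{t=1}^T\ell_{t,A_t}-\ell_{t,a^*}\big]$ of the $(\alpha,R)$-hedged FTRL algorithm with learning rate $\eta=\sqrt{\mathrm{diam}(F)/(\mathrm{stab}(F)T)}$ satisfies $$\mathsf{Reg}_M(T)\le 2\sqrt{\mathrm{stab}(F)\,\mathrm{diam}(F)\,T}+\Big[\frac{\alpha}{1-\alpha}\sum_{i=1}^M\big(\rho_{1,i}^{\alpha-1}-\mathbb E[\rho_{T,i}^{\alpha-1}]\big)+\rho_{1,a^*}^\alpha-\mathbb E[\rho_{T,a^*}^\alpha]\Big]\cdot R .$$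
   Context: Adversarial multi-armed bandit with $M$ arms: at each round $t=1,\dots,T$ an adversary fixes a loss vector $\ell_t\in[0,L]^M$ (before $A_t$ is drawn), the agent draws $A_t\sim p_t\in\Delta([M])$ and observes only $\ell_{t,A_t}$. $\Delta([M])$ is the probability simplex. Potential: $F(x)=\sum_{i=1}^M c_if(x_i)$ with $c_i>0$ and $f:[0,\infty)\to\mathbb R$ continuous, strictly convex, continuously differentiable on $(0,\infty)$, with $f'(x)\to-\infty$ as $x\to0^+$ (a separable Legendre potential). For $\eta>0$, $\bar F_\eta^*(-L')=\max_{p\in\Delta([M])}\{\langle p,-L'\rangle-\eta^{-1}F(p)\}$ for $L'\in\mathbb R^M$; $D_G(x,y)=G(x)-G(y)-\langle x-y,\nabla G(y)\rangle$ is the Bregman divergence. Define $$\mathrm{stab}(F)=\sup_{\eta>0}\ \sup_{x\in\Delta([M])}\ \sup_{\ell\in[0,L]^M}\eta^{-1}\,\mathbb E_{A\sim x}\Big[D_{\bar F_\eta^*}\big(\eta^{-1}\nabla F(x)-\tfrac{\ell_A}{x_A}\mathbf e_A,\ \eta^{-1}\nabla F(x)\big)\Big]$$ (with $x$ in the interior of the simplex, where $\nabla F$ is defined), and $\mathrm{diam}(F)=\max_{p\in\Delta([M])}F(p)-\min_{p\in\Delta([M])}F(p)$. $(\alpha,R)$-hedged FTRL with learning rate $\eta$: let $p_1=\operatorname{argmin}_{p\in\Delta([M])}F(p)$, and let $\rho_{t,i}=\max_{s\le t}p_{s,i}^{-1}$. Initialize $B_{0,i}=\rho_{1,i}^\alpha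 R$ for $i\in[M]$. At round $t$, play $A_t\sim p_t$, set $\hat\ell_t=\frac{\ell_{t,A_t}}{p_{t,A_t}}\mathbf e_{A_t}$, $\hat L_t=\sum_{s\le t}\hat\ell_s$, and compute $\tilde p_{t+1}=\operatorname{argmin}_{p\in\Delta([M])}\langle p,\hat L_t-(B_{t-1}-B_0)\rangle+\eta^{-1}F(p)$. If $\tilde p_{t+1,A_t}^{-\alpha}R\le B_{t-1,A_t}$, set $B_t=B_{t-1}$, $p_{t+1}=\tilde p_{t+1}$. Otherwise choose the unique $b_t>0$ such that with $B_t=B_{t-1}+b_t\mathbf e_{A_t}$ one has simultaneously $p_{t+1}=\operatorname{argmin}_{p\in\Delta([M])}\langle p,\hat L_t-(B_t-B_0)\rangle+\eta^{-1}F(p)$ and $p_{t+1,A_t}^{-\alpha}R=B_{t,A_t}$. *)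

theory Defs
  imports "HOL-Probability.Probability"
begin

section \<open>Potentials on the probability simplex\<close>

text \<open>The arms are the elements of a finite type \<open>'n\<close>, so \<open>M = CARD('n)\<close>.\<close>

definition prob_simplex :: "(real ^ 'n) set" where
  "prob_simplex = {p. (\<forall>i. 0 \<le> p $ i) \<and> (\<Sum>i\<in>UNIV. p $ i) = 1}"

text \<open>The relative interior; the interior in the ambient space is empty.\<close>

definition prob_simplex_interior :: "(real ^ 'n) set" where
  "prob_simplex_interior = {p \<in> prob_simplex. \<forall>i. 0 < p $ i}"

definition strictly_convex_on :: "real set \<Rightarrow> (real \<Rightarrow> real) \<Rightarrow> bool" where
  "strictly_convex_on S f \<longleftrightarrow> convex S \<and>
     (\<forall>x\<in>S. \<forall>y\<in>S. \<forall>u. x \<noteq> y \<and> 0 < u \<and> u < 1 \<longrightarrow>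
        f ((1 - u) * x + u * y) < (1 - u) * f x + u * f y)"

text \<open>Only the values of \<open>f\<close> on \<open>[0,\<infinity>)\<close> matter; its values at negative
  arguments are arbitrary.\<close>

definition legendre_function :: "(real \<Rightarrow> real) \<Rightarrow> bool" where
  "legendre_function f \<longleftrightarrow>
     continuous_on {0..} f \<and> strictly_convex_on {0..} f \<and>
     f C1_differentiable_on {0<..} \<and> filterlim (deriv f) at_bot (at_right 0)"

definition separable_potential :: "real ^ 'n \<Rightarrow> (real \<Rightarrow> real) \<Rightarrow> real ^ 'n \<Rightarrow> real" where
  "separable_potential c f x = (\<Sum>i\<in>UNIV. c $ i * f (x $ i))"

definition gradient :: "('a::real_inner \<Rightarrow> real) \<Rightarrow> 'a \<Rightarrow> 'a" where
  "gradient G x = (THE D. GDERIV G x :> D)"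

definition bregman :: "('a::real_inner \<Rightarrow> real) \<Rightarrow> 'a \<Rightarrow> 'a \<Rightarrow> real" where
  "bregman G x y = G x - G y - inner (x - y) (gradient G y)"

text \<open>For continuous \<open>F\<close> the supremum is a maximum, by compactness of the simplex.\<close>

definition simplex_conjugate :: "real \<Rightarrow> (real ^ 'n \<Rightarrow> real) \<Rightarrow> real ^ 'n \<Rightarrow> real" where
  "simplex_conjugate \<eta> F y = (SUP p\<in>prob_simplex. inner p y - inverse \<eta> * F p)"

text \<open>The finite sum below is the expectation over an arm \<open>A\<close> drawn from \<open>x\<close>.\<close>

definition stab :: "real \<Rightarrow> (real ^ 'n \<Rightarrow> real) \<Rightarrow> ereal" where
  "stab L F =
     (SUP \<eta>\<in>{0<..}. SUP x\<in>prob_simplex_interior. SUP l\<in>{l. \<forall>i. l $ i \<in> {0..L}}.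
        ereal (inverse \<eta> * (\<Sum>A\<in>UNIV. x $ A *
          bregman (simplex_conjugate \<eta> F)
            (inverse \<eta> *\<^sub>R gradient F x - axis A (l $ A / x $ A))
            (inverse \<eta> *\<^sub>R gradient F x))))"

definition potential_diam :: "(real ^ 'n \<Rightarrow> real) \<Rightarrow> ereal" where
  "potential_diam F = (SUP p\<in>prob_simplex. ereal (F p)) - (INF p\<in>prob_simplex. ereal (F p))"

section \<open>Hedged FTRL\<close>

definition init_dist :: "(real ^ 'n \<Rightarrow> real) \<Rightarrow> real ^ 'n" where
  "init_dist F = arg_min_on F prob_simplex"

definition ftrl_dist :: "real \<Rightarrow> (real ^ 'n \<Rightarrow> real) \<Rightarrow> real ^ 'n \<Rightarrow> real ^ 'n" where
  "ftrl_dist \<eta> F \<Theta> = arg_min_on (\<lambda>p. inner p \<Theta> + inverse \<eta> * F p) prob_simplex"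

definition init_rho :: "(real ^ 'n \<Rightarrow> real) \<Rightarrow> 'n \<Rightarrow> real" where
  "init_rho F i = inverse (init_dist F $ i)"

definition init_bias :: "(real ^ 'n \<Rightarrow> real) \<Rightarrow> real \<Rightarrow> real \<Rightarrow> real ^ 'n" where
  "init_bias F \<alpha> R = (\<chi> i. init_rho F i powr \<alpha> * R)"

text \<open>\<open>hedged_state \<eta> F \<alpha> R a y t\<close> is the triple \<open>(Lh\<^sub>t, B\<^sub>t, p\<^sub>t\<^sub>+\<^sub>1)\<close> after
  \<open>t\<close> rounds, with \<open>Lh\<^sub>t\<close> the cumulative importance-weighted loss estimate; \<open>a s\<close> is the
  arm played and \<open>y s\<close> the scalar loss observed in round \<open>s \<ge> 1\<close>. Nothing else about the
  losses is available to the algorithm.\<close>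

primrec hedged_state ::
  "real \<Rightarrow> (real ^ 'n \<Rightarrow> real) \<Rightarrow> real \<Rightarrow> real \<Rightarrow> (nat \<Rightarrow> 'n) \<Rightarrow> (nat \<Rightarrow> real) \<Rightarrow> nat \<Rightarrow>
     (real ^ 'n) \<times> (real ^ 'n) \<times> (real ^ 'n)" where
  "hedged_state \<eta> F \<alpha> R a y 0 = (0, init_bias F \<alpha> R, init_dist F)"
| "hedged_state \<eta> F \<alpha> R a y (Suc t) =
     (let (Lh, B, p) = hedged_state \<eta> F \<alpha> R a y t;
          i = a (Suc t);
          Lh' = Lh + axis i (y (Suc t) / p $ i);
          q = (\<lambda>B'. ftrl_dist \<eta> F (Lh' - (B' - init_bias F \<alpha> R)))
      in if (q B $ i) powr (- \<alpha>) * R \<le> B $ i then (Lh', B, q B)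
         else let b = (THE b. 0 < b \<and>
                         (q (B + axis i b) $ i) powr (- \<alpha>) * R = (B + axis i b) $ i);
                  B' = B + axis i b
              in (Lh', B', q B'))"

text \<open>The distribution \<open>p\<^sub>t\<close> used in round \<open>t \<ge> 1\<close>.\<close>

definition hedged_dist ::
  "real \<Rightarrow> (real ^ 'n \<Rightarrow> real) \<Rightarrow> real \<Rightarrow> real \<Rightarrow> (nat \<Rightarrow> 'n) \<Rightarrow> (nat \<Rightarrow> real) \<Rightarrow> nat \<Rightarrow> real ^ 'n"
  where "hedged_dist \<eta> F \<alpha> R a y t = snd (snd (hedged_state \<eta> F \<alpha> R a y (t - 1)))"

section \<open>The bandit interaction\<close>

text \<open>\<open>G t\<close> is the information available just before the arm \<open>A t\<close> is drawn, including
  the loss vector of round \<open>t\<close>. The adversary may be adaptive and randomized: the losses of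
  round \<open>t\<close> may depend on all previous arms and on additional randomness in \<open>G t\<close>.\<close>

locale bandit_interaction = prob_space M + filtration "space M" G
  for M :: "'w measure" and G :: "nat \<Rightarrow> 'w measure" +
  fixes T :: nat and L :: real
    and loss :: "nat \<Rightarrow> 'w \<Rightarrow> real ^ 'n" and A :: "nat \<Rightarrow> 'w \<Rightarrow> 'n"
    and p :: "nat \<Rightarrow> 'w \<Rightarrow> real ^ 'n"
  assumes subalgebra: "subalgebra M (G t)"
    and loss_range: "t \<in> {1..T} \<Longrightarrow> \<omega> \<in> space M \<Longrightarrow> loss t \<omega> $ i \<in> {0..L}"
    and loss_measurable: "t \<in> {1..T} \<Longrightarrow> loss t \<in> borel_measurable (G t)"
    and arm_measurable: "t \<in> {1..T} \<Longrightarrow> A t \<in> measurable (G (Suc t)) (count_space UNIV)"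
    and arm_law: "t \<in> {1..T} \<Longrightarrow>
      AE \<omega> in M. real_cond_exp M (G t) (indicat_real {\<omega> \<in> space M. A t \<omega> = i}) \<omega> = p t \<omega> $ i"

end

(*
  Let Phi(y) = max_p <p, y> - F(p) / eta over the simplex. Its gradient at y is the FTRL choice for
  the dual point -y. Writing Theta_t for the estimated losses minus the bonuses granted so far, the
  regret is bounded by telescoping Phi(-Theta_t). The loss part of a step contributes the observed
  loss and a Bregman divergence, whose conditional expectation is at most eta stab(F), because
  grad F(p_t) / eta and -Theta_{t-1} differ by a multiple of the all-ones vector, which the
  divergence ignores. The bonus part costs at most b_t p_{t+1,A_t} by convexity.

  Raising one dual coordinate lowers the corresponding probability and no other, so the bias is
  B_{t,i} = R rho_{t+1,i}^alpha throughout. Hence the cost of a bonus is at most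
  R (rho'^alpha - rho^alpha) / rho' <= alpha/(1-alpha) R (rho^(alpha-1) - rho'^(alpha-1)), which
  telescopes, and the comparator gains B_{T-1,a} - B_{0,a}. Integrability holds because all the
  probabilities up to round T are bounded away from 0 by a deterministic constant: the dual points
  stay in a compact set, on which the positive map to the FTRL choice is continuous.
*)
theory Submission
  imports Defs
begin

section \<open>The probability simplex and preliminaries on coordinates and gradients\<close>

lemma closed_prob_simplex: "closed (prob_simplex :: (real ^ 'n) set)"
proof -
  have "prob_simplex = (\<Inter>i. {p::real ^ 'n. 0 \<le> p $ i}) \<inter> {p. (\<Sum>i\<in>UNIV. p $ i) = 1}"
    by (auto simp: prob_simplex_def)
  moreover have "closed ((\<Inter>i. {p::real ^ 'n. 0 \<le> p $ i}) \<inter> {p. (\<Sum>i\<in>UNIV. p $ i) = 1})"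
    by (intro closed_Int closed_INT ballI closed_Collect_le closed_Collect_eq continuous_intros)
  ultimately show ?thesis by simp
qed

lemma prob_simplex_nth:
  assumes "p \<in> prob_simplex"
  shows "0 \<le> p $ i" "p $ i \<le> 1" "(\<Sum>i\<in>UNIV. p $ i) = 1"
proof -
  show nonneg: "0 \<le> p $ i" and sum: "(\<Sum>i\<in>UNIV. p $ i) = 1" for i
    using assms by (auto simp: prob_simplex_def)
  show "p $ i \<le> 1"
    using member_le_sum[of i UNIV "\<lambda>i. p $ i"] nonneg by (simp add: sum)
qed

lemma norm_prob_simplex_le: "p \<in> prob_simplex \<Longrightarrow> norm p \<le> 1"
  using norm_le_l1_cart[of p] by (simp add: prob_simplex_nth)

lemma compact_prob_simplex: "compact (prob_simplex :: (real ^ 'n) set)"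
  unfolding compact_eq_bounded_closed bounded_iff
  using closed_prob_simplex norm_prob_simplex_le by blast

lemma axis_in_prob_simplex: "axis i 1 \<in> (prob_simplex :: (real ^ 'n) set)"
  by (auto simp: prob_simplex_def axis_def)

lemma prob_simplex_nonempty: "(prob_simplex :: (real ^ 'n) set) \<noteq> {}"
  using axis_in_prob_simplex by blast

lemma midpoint_in_prob_simplex:
  "p \<in> prob_simplex \<Longrightarrow> q \<in> prob_simplex \<Longrightarrow> (1/2) *\<^sub>R (p + q) \<in> prob_simplex"
  by (auto simp: prob_simplex_def sum.distrib sum_divide_distrib[symmetric])

lemma inner_prob_simplex_vec: "p \<in> prob_simplex \<Longrightarrow> inner p (vec \<kappa>) = \<kappa>"
  using prob_simplex_nth(3)[of p] by (simp add: inner_vec_def sum_distrib_right[symmetric])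

lemma norm_axis: "norm (axis i x :: real ^ 'n) = \<bar>x\<bar>"
  by (simp add: norm_eq_sqrt_inner inner_axis_axis)

lemma continuous_axis: "continuous_on S (axis i :: real \<Rightarrow> real ^ 'n)"
proof -
  have "continuous_on S (\<lambda>x. x *\<^sub>R axis i (1::real) :: real ^ 'n)"
    by (intro continuous_intros)
  moreover have "(\<lambda>x. x *\<^sub>R axis i 1) = (axis i :: real \<Rightarrow> real ^ 'n)"
    by (auto simp: fun_eq_iff vec_eq_iff axis_def)
  ultimately show ?thesis by (simp only:)
qed

lemma measurable_axis [measurable]: "(axis i :: real \<Rightarrow> real ^ 'n) \<in> borel_measurable borel"
  by (rule borel_measurable_continuous_onI[OF continuous_axis])

lemma measurable_nth [measurable]: "(\<lambda>x :: real ^ 'n. x $ i) \<in> borel_measurable borel"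
  by (intro borel_measurable_continuous_onI continuous_intros)

text \<open>Uniqueness of the derivative makes the definite description in \<open>gradient\<close>
  denote it.\<close>

lemma gradient_eqI:
  assumes "GDERIV G x :> D"
  shows "gradient G x = D"
  unfolding gradient_def
proof (rule the_equality[where P = "\<lambda>D. GDERIV G x :> D", OF assms])
  fix D' assume "GDERIV G x :> D'"
  then have "(\<lambda>h. inner h D') = (\<lambda>h. inner h D)"
    using assms unfolding gderiv_def by (rule has_derivative_unique)
  then have "\<forall>h. inner h D' = inner h D"
    by (simp add: fun_eq_iff)
  then show "D' = D"
    by (simp only: vector_eq_ldot)
qed

section \<open>Strictly convex regularizers on the simplex\<close>

text \<open>Strict convexity is stated at midpoints, where the uniqueness proof evaluates it.
  Separable structure enters later, for positivity and for comparing coordinates.\<close>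

locale simplex_regularizer =
  fixes F :: "real ^ 'n \<Rightarrow> real" and \<eta> :: real
  assumes continuous_F: "continuous_on prob_simplex F"
    and midpoint_less: "\<And>p q. p \<in> prob_simplex \<Longrightarrow> q \<in> prob_simplex \<Longrightarrow> p \<noteq> q \<Longrightarrow>
      F ((1/2) *\<^sub>R (p + q)) < (F p + F q) / 2"
    and eta_pos: "0 < \<eta>"
begin

abbreviation choice :: "real ^ 'n \<Rightarrow> real ^ 'n" where
  "choice \<equiv> ftrl_dist \<eta> F"

abbreviation conjugate :: "real ^ 'n \<Rightarrow> real" where
  "conjugate \<equiv> simplex_conjugate \<eta> F"

text \<open>At the midpoint of two distinct minimizers the linear term averages while
  \<open>F\<close> falls strictly below the average, so the midpoint would beat both.\<close>

lemma objective_min_unique: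
  assumes "p \<in> prob_simplex" "q \<in> prob_simplex"
    and "\<And>r. r \<in> prob_simplex \<Longrightarrow> inner p \<Theta> + inverse \<eta> * F p \<le> inner r \<Theta> + inverse \<eta> * F r"
    and "\<And>r. r \<in> prob_simplex \<Longrightarrow> inner q \<Theta> + inverse \<eta> * F q \<le> inner r \<Theta> + inverse \<eta> * F r"
  shows "p = q"
proof (rule ccontr)
  assume ne: "p \<noteq> q"
  let ?m = "(1/2) *\<^sub>R (p + q)"
  have m: "?m \<in> prob_simplex" using assms by (intro midpoint_in_prob_simplex)
  have "inverse \<eta> * F ?m < inverse \<eta> * ((F p + F q) / 2)"
    using midpoint_less[OF assms(1,2) ne] eta_pos by simp
  moreover have "inverse \<eta> * ((F p + F q) / 2) = (inverse \<eta> * F p + inverse \<eta> * F q) / 2"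
    by (simp add: algebra_simps add_divide_distrib)
  moreover have "inner ?m \<Theta> = (inner p \<Theta> + inner q \<Theta>) / 2"
    by (simp add: inner_add_left)
  ultimately show False using assms(3)[OF m] assms(4)[OF m] by argo
qed

text \<open>Compactness and continuity provide a minimizer, so the Hilbert choice inside
  \<open>arg_min_on\<close> does return one.\<close>

lemma
  shows choice_in: "choice \<Theta> \<in> prob_simplex"
    and choice_le: "q \<in> prob_simplex \<Longrightarrow>
      inner (choice \<Theta>) \<Theta> + inverse \<eta> * F (choice \<Theta>) \<le> inner q \<Theta> + inverse \<eta> * F q"
proof -
  have "continuous_on prob_simplex (\<lambda>p. inner p \<Theta> + inverse \<eta> * F p)"
    by (intro continuous_intros continuous_F)
  then obtain p where "is_arg_min (\<lambda>p. inner p \<Theta> + inverse \<eta> * F p) (\<lambda>p. p \<in> prob_simplex) p"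
    using continuous_attains_inf[OF compact_prob_simplex prob_simplex_nonempty]
    unfolding is_arg_min_linorder by blast
  then have "is_arg_min (\<lambda>p. inner p \<Theta> + inverse \<eta> * F p) (\<lambda>p. p \<in> prob_simplex) (choice \<Theta>)"
    unfolding ftrl_dist_def arg_min_on_def arg_min_def by (rule someI)
  then show "choice \<Theta> \<in> prob_simplex" "q \<in> prob_simplex \<Longrightarrow>
      inner (choice \<Theta>) \<Theta> + inverse \<eta> * F (choice \<Theta>) \<le> inner q \<Theta> + inverse \<eta> * F q"
    unfolding is_arg_min_linorder by auto
qed

lemma choice_eqI:
  assumes "p \<in> prob_simplex"
    and "\<And>q. q \<in> prob_simplex \<Longrightarrow> inner p \<Theta> + inverse \<eta> * F p \<le> inner q \<Theta> + inverse \<eta> * F q"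
  shows "choice \<Theta> = p"
  using objective_min_unique[OF choice_in assms(1) choice_le assms(2)] .

text \<open>An arg min depends only on the strict order of the objective values, which the positive
  factor \<open>inverse \<eta>\<close> preserves. The first round thus becomes the case of dual
  point 0.\<close>

lemma init_dist_eq_choice: "init_dist F = choice 0"
proof -
  have "(F x < F y) = (inner x 0 + inverse \<eta> * F x < inner y 0 + inverse \<eta> * F y)" for x y
    using eta_pos by simp
  then show ?thesis
    unfolding init_dist_def ftrl_dist_def arg_min_on_def arg_min_def is_arg_min_def by (simp only:)
qed

section \<open>The conjugate, its gradient map and invariance under constant vectors\<close>

lemma conjugate_eq: "conjugate y = inner (choice (- y)) y - inverse \<eta> * F (choice (- y))"
  unfolding simplex_conjugate_def
proof (rule cSup_eq_maximum)
  show "inner (choice (- y)) y - inverse \<eta> * F (choice (- y))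
      \<in> (\<lambda>p. inner p y - inverse \<eta> * F p) ` prob_simplex"
    using choice_in by (rule imageI)
  fix x assume "x \<in> (\<lambda>p. inner p y - inverse \<eta> * F p) ` prob_simplex"
  then obtain p where "p \<in> prob_simplex" and x: "x = inner p y - inverse \<eta> * F p" by blast
  then show "x \<le> inner (choice (- y)) y - inverse \<eta> * F (choice (- y))"
    using choice_le[of p "- y"] by simp
qed

lemma conjugate_ge:
  assumes "p \<in> prob_simplex"
  shows "inner p y - inverse \<eta> * F p \<le> conjugate y"
  using choice_le[OF assms, of "- y"] by (simp add: conjugate_eq)

text \<open>The maximizer at \<open>y\<close> is a feasible competitor at \<open>z\<close>, and its
  objective is affine in the dual variable.\<close>

lemma conjugate_subgradient: "conjugate y + inner (choice (- y)) (z - y) \<le> conjugate z"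
  using conjugate_ge[OF choice_in, of "- y" z] by (simp add: conjugate_eq[of y] inner_diff_right)

text \<open>The subgradients lie in the simplex, where the Euclidean norm is at most 1.\<close>

lemma conjugate_lipschitz: "\<bar>conjugate z - conjugate y\<bar> \<le> norm (z - y)"
proof -
  have "\<bar>inner (choice w) v\<bar> \<le> norm v" for w v
    using Cauchy_Schwarz_ineq2[of "choice w" v] norm_prob_simplex_le[OF choice_in, of w]
    by (smt (verit) mult_left_le_one_le norm_ge_zero)
  from this[of "- y" "z - y"] this[of "- z" "y - z"]
  show ?thesis using conjugate_subgradient[of y z] conjugate_subgradient[of z y]
    by (auto simp: norm_minus_commute)
qed

text \<open>Adding the subgradient inequalities at \<open>- \<Theta>\<close> and
  \<open>- \<Theta>'\<close> cancels the conjugate values.\<close>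

lemma choice_monotone: "inner (choice \<Theta> - choice \<Theta>') (\<Theta> - \<Theta>') \<le> 0"
  using conjugate_subgradient[of "- \<Theta>" "- \<Theta>'"] conjugate_subgradient[of "- \<Theta>'" "- \<Theta>"]
  by (simp add: inner_diff_left inner_diff_right)

lemma choice_nth_antimono:
  assumes "s \<le> s'"
  shows "choice (\<Theta> + axis i s') $ i \<le> choice (\<Theta> + axis i s) $ i"
proof (cases "s = s'")
  case False
  have "(\<Theta> + axis i s') - (\<Theta> + axis i s) = axis i (s' - s)"
    by (simp add: vec_eq_iff axis_def)
  then have "(choice (\<Theta> + axis i s') $ i - choice (\<Theta> + axis i s) $ i) * (s' - s) \<le> 0"
    using choice_monotone[of "\<Theta> + axis i s'" "\<Theta> + axis i s"] by (simp add: inner_axis)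
  then show ?thesis using assms False by (simp add: mult_le_0_iff)
qed simp

text \<open>The optimality inequality against each fixed competitor survives limits, so a limit of
  minimizers minimizes the limiting objective; uniqueness identifies it with the choice.\<close>

lemma closed_choice_graph: "closed ((\<lambda>\<Theta>. (\<Theta>, choice \<Theta>)) ` UNIV)"
proof (subst closed_sequential_limits, intro allI impI)
  fix X l assume "(\<forall>n. X n \<in> range (\<lambda>\<Theta>. (\<Theta>, choice \<Theta>))) \<and> X \<longlonglongrightarrow> l"
  then have "\<exists>\<Theta>. X n = (\<Theta>, choice \<Theta>)" and lim: "X \<longlonglongrightarrow> l" for n
    by blast+
  then have X: "snd (X n) = choice (fst (X n))" for n
    by (metis fst_conv snd_conv)
  obtain \<Theta> p where l: "l = (\<Theta>, p)" by (cases l)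
  have 1: "(\<lambda>n. fst (X n)) \<longlonglongrightarrow> \<Theta>" and 2: "(\<lambda>n. snd (X n)) \<longlonglongrightarrow> p"
    using tendsto_fst[OF lim] tendsto_snd[OF lim] l by auto
  have p: "p \<in> prob_simplex"
    by (rule closed_sequentially[OF closed_prob_simplex _ 2]) (simp add: X choice_in)
  have 3: "(\<lambda>n. F (snd (X n))) \<longlonglongrightarrow> F p"
    by (rule continuous_on_tendsto_compose[OF continuous_F 2 p]) (simp add: X choice_in)
  have "choice \<Theta> = p"
  proof (rule choice_eqI[OF p])
    fix q :: "real ^ 'n" assume q: "q \<in> prob_simplex"
    show "inner p \<Theta> + inverse \<eta> * F p \<le> inner q \<Theta> + inverse \<eta> * F q"
    proof (rule LIMSEQ_le)
      show "(\<lambda>n. inner (snd (X n)) (fst (X n)) + inverse \<eta> * F (snd (X n)))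
          \<longlonglongrightarrow> inner p \<Theta> + inverse \<eta> * F p"
        by (intro tendsto_intros 1 2 3)
      show "(\<lambda>n. inner q (fst (X n)) + inverse \<eta> * F q) \<longlonglongrightarrow> inner q \<Theta> + inverse \<eta> * F q"
        by (intro tendsto_intros 1)
    qed (simp add: X choice_le[OF q])
  qed
  then show "l \<in> range (\<lambda>\<Theta>. (\<Theta>, choice \<Theta>))" using l by auto
qed

text \<open>A map into a compact set with closed graph is continuous.\<close>

lemma continuous_choice: "continuous_on UNIV choice"
  by (rule continuous_from_closed_graph[OF compact_prob_simplex])
     (use choice_in closed_choice_graph in auto)

text \<open>The subgradient inequalities at \<open>y\<close> and at \<open>y + h\<close> place the
  first-order remainder between 0 and the inner product of \<open>h\<close> with the change of the
  choice, which continuity makes small relative to \<open>norm h\<close>.\<close>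

lemma GDERIV_conjugate: "GDERIV conjugate y :> choice (- y)"
  unfolding gderiv_def has_derivative_at
proof (intro conjI)
  show "bounded_linear (\<lambda>h. inner h (choice (- y)))" by (rule bounded_linear_inner_left)
  have "isCont choice (- y)"
    using continuous_choice by (simp add: continuous_on_eq_continuous_at)
  then have "((\<lambda>h. choice (- y - h)) \<longlongrightarrow> choice (- y)) (at 0)"
    by (rule isCont_tendsto_compose) (rule tendsto_eq_intros | simp)+
  then have lim: "((\<lambda>h. norm (choice (- y - h) - choice (- y))) \<longlongrightarrow> 0) (at 0)"
    by (rule LIM_zero[THEN tendsto_norm_zero])
  show "(\<lambda>h. norm (conjugate (y + h) - conjugate y - inner h (choice (- y))) / norm h) \<midarrow>0\<rightarrow> 0"
  proof (rule Lim_null_comparison[OF _ lim], rule always_eventually, rule allI)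
    fix h
    have "0 \<le> conjugate (y + h) - conjugate y - inner h (choice (- y))"
      using conjugate_subgradient[of y "y + h"] by (simp add: inner_commute)
    moreover have "conjugate (y + h) - conjugate y - inner h (choice (- y))
        \<le> inner (choice (- y - h) - choice (- y)) h"
      using conjugate_subgradient[of "y + h" y] by (simp add: inner_commute inner_diff_right inner_diff_left)
    moreover have "\<dots> \<le> norm (choice (- y - h) - choice (- y)) * norm h"
      by (rule norm_cauchy_schwarz)
    ultimately show "norm (norm (conjugate (y + h) - conjugate y - inner h (choice (- y))) / norm h)
        \<le> norm (choice (- y - h) - choice (- y))"
      by (cases "h = 0") (simp_all add: divide_le_eq)
  qed
qed

lemma gradient_conjugate: "gradient conjugate y = choice (- y)"
  by (rule gradient_eqI[OF GDERIV_conjugate])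

lemma continuous_conjugate: "continuous_on UNIV conjugate"
  using GDERIV_conjugate has_derivative_continuous
  unfolding gderiv_def continuous_on_eq_continuous_at[OF open_UNIV] by blast

text \<open>Simplex coordinates sum to 1, so a constant vector adds the same number to every
  objective value.\<close>

lemma conjugate_shift: "conjugate (y + vec \<kappa>) = conjugate y + \<kappa>"
proof (rule antisym)
  show "conjugate (y + vec \<kappa>) \<le> conjugate y + \<kappa>"
    using conjugate_ge[OF choice_in, of "- (y + vec \<kappa>)" y]
      inner_prob_simplex_vec[OF choice_in, of "- (y + vec \<kappa>)"]
    by (simp add: conjugate_eq[of "y + vec \<kappa>"] inner_add_right)
  show "conjugate y + \<kappa> \<le> conjugate (y + vec \<kappa>)"
    using conjugate_ge[OF choice_in, of "- y" "y + vec \<kappa>"]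
      inner_prob_simplex_vec[OF choice_in, of "- y"]
    by (simp add: conjugate_eq[of y] inner_add_right)
qed

lemma choice_shift: "choice (\<Theta> + vec \<kappa>) = choice \<Theta>"
  using choice_le
  by (intro choice_eqI choice_in) (simp add: inner_add_right inner_prob_simplex_vec choice_in)

lemma bregman_conjugate_shift: "bregman conjugate (x + vec \<kappa>) (y + vec \<kappa>) = bregman conjugate x y"
proof -
  have "- (y + vec \<kappa>) = - y + vec (- \<kappa>)" by (simp add: vec_eq_iff)
  then show ?thesis
    unfolding bregman_def gradient_conjugate conjugate_shift by (simp only: choice_shift) simp
qed

end

section \<open>Separable Legendre potentials\<close>

locale legendre_potential =
  fixes c :: "real ^ 'n" and f :: "real \<Rightarrow> real" and \<eta> :: real
  assumes weight_pos: "0 < c $ i"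
    and legendre: "legendre_function f"
    and rate_pos: "0 < \<eta>"
begin

abbreviation F :: "real ^ 'n \<Rightarrow> real" where
  "F \<equiv> separable_potential c f"

lemma f_midpoint_less:
  assumes "0 \<le> x" "0 \<le> y" "x \<noteq> y"
  shows "f ((x + y) / 2) < (f x + f y) / 2"
proof -
  have "f ((1 - 1/2) * x + 1/2 * y) < (1 - 1/2) * f x + 1/2 * f y"
    using legendre assms unfolding legendre_function_def strictly_convex_on_def
    by (elim conjE) (drule bspec[of _ _ x], simp, drule bspec[of _ _ y], simp, drule spec[of _ "1/2"], simp)
  then show ?thesis by (simp add: field_simps)
qed

lemma DERIV_f: "0 < x \<Longrightarrow> (f has_real_derivative deriv f x) (at x)"
  using legendre
  by (auto simp: legendre_function_def C1_differentiable_on_eq DERIV_deriv_iff_real_differentiable)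

lemma convex_on_f: "convex_on {0..} f"
proof (rule convex_onI)
  fix t x y :: real
  assume t: "0 < t" "t < 1" and xy: "x \<in> {0..}" "y \<in> {0..}"
  show "f ((1 - t) *\<^sub>R x + t *\<^sub>R y) \<le> (1 - t) * f x + t * f y"
  proof (cases "x = y")
    case True
    then show ?thesis by (simp add: algebra_simps)
  next
    case False
    then show ?thesis
      using legendre t xy unfolding legendre_function_def strictly_convex_on_def
      by (fastforce intro: less_imp_le)
  qed
qed (rule convex_real_interval)

text \<open>The weak tangent inequality is applied at the midpoint of \<open>x\<close> and
  \<open>y\<close>; strict midpoint convexity then makes it strict at \<open>y\<close>.\<close>

lemma f_tangent_less:
  assumes "0 < x" "0 \<le> y" "x \<noteq> y"
  shows "deriv f x * (y - x) < f y - f x"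
proof -
  have "deriv f x * ((x + y) / 2 - x) \<le> f ((x + y) / 2) - f x"
    using assms
    by (intro convex_on_imp_above_tangent[OF convex_on_f])
       (auto simp: interior_Ici intro: has_field_derivative_at_within DERIV_f)
  moreover have "f ((x + y) / 2) < (f x + f y) / 2"
    using assms by (intro f_midpoint_less) auto
  ultimately show ?thesis by argo
qed

lemma deriv_f_less:
  assumes "0 < x" "x < y"
  shows "deriv f x < deriv f y"
proof -
  have "deriv f x * (y - x) < deriv f y * (y - x)"
    using f_tangent_less[of x y] f_tangent_less[of y x] assms by (simp add: algebra_simps)
  then show ?thesis using assms by simp
qed

lemma continuous_separable: "continuous_on prob_simplex F"
  unfolding separable_potential_def
proof (intro continuous_intros)
  fix i :: 'n
  have "continuous_on {0..} f" using legendre by (simp add: legendre_function_def)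
  then show "continuous_on prob_simplex (\<lambda>x. f (x $ i))"
    by (rule continuous_on_compose2) (auto intro!: continuous_intros simp: prob_simplex_nth)
qed

lemma separable_midpoint_less:
  assumes "p \<in> prob_simplex" "q \<in> prob_simplex" "p \<noteq> q"
  shows "F ((1/2) *\<^sub>R (p + q)) < (F p + F q) / 2"
proof -
  obtain i where i: "p $ i \<noteq> q $ i" using assms(3) by (auto simp: vec_eq_iff)
  have "(\<Sum>i\<in>UNIV. c $ i * f ((p $ i + q $ i) / 2)) < (\<Sum>i\<in>UNIV. c $ i * ((f (p $ i) + f (q $ i)) / 2))"
  proof (rule sum_strict_mono_ex1)
    show "\<forall>i\<in>UNIV. c $ i * f ((p $ i + q $ i) / 2) \<le> c $ i * ((f (p $ i) + f (q $ i)) / 2)"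
    proof
      fix i
      show "c $ i * f ((p $ i + q $ i) / 2) \<le> c $ i * ((f (p $ i) + f (q $ i)) / 2)"
        using f_midpoint_less[of "p $ i" "q $ i"] weight_pos[of i] assms(1,2)
        by (cases "p $ i = q $ i") (auto simp: prob_simplex_nth intro!: mult_left_mono)
    qed
    show "\<exists>i\<in>UNIV. c $ i * f ((p $ i + q $ i) / 2) < c $ i * ((f (p $ i) + f (q $ i)) / 2)"
      using f_midpoint_less[of "p $ i" "q $ i"] weight_pos[of i] assms(1,2) i
      by (intro bexI[of _ i]) (auto simp: prob_simplex_nth)
  qed simp
  also have "\<dots> = (F p + F q) / 2"
    by (simp add: separable_potential_def sum.distrib[symmetric] sum_divide_distrib distrib_left)
  finally show ?thesis by (simp add: separable_potential_def)
qed

sublocale simplex_regularizer F \<eta>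
  using continuous_separable separable_midpoint_less rate_pos by unfold_locales

text \<open>The competitor moves mass \<open>\<epsilon>\<close> from arm \<open>j\<close> to arm \<open>i\<close>.\<close>

lemma choice_exchange:
  assumes p: "p = choice \<Theta>" and "i \<noteq> j" and \<epsilon>: "- (p $ i) \<le> \<epsilon>" "\<epsilon> \<le> p $ j"
  shows "0 \<le> \<epsilon> * (\<Theta> $ i - \<Theta> $ j) +
    inverse \<eta> * (c $ i * (f (p $ i + \<epsilon>) - f (p $ i)) + c $ j * (f (p $ j - \<epsilon>) - f (p $ j)))"
proof -
  define q where "q = p + axis i \<epsilon> - axis j \<epsilon>"
  have pin: "p \<in> prob_simplex" using choice_in p by simp
  have upd: "(\<Sum>k\<in>UNIV. g k (q $ k)) = (\<Sum>k\<in>UNIV. g k (p $ k)) +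
      (g i (p $ i + \<epsilon>) - g i (p $ i)) + (g j (p $ j - \<epsilon>) - g j (p $ j))"
    for g :: "'n \<Rightarrow> real \<Rightarrow> real"
  proof -
    have "(\<Sum>k\<in>UNIV. g k (q $ k) - g k (p $ k)) = (\<Sum>k\<in>{i, j}. g k (q $ k) - g k (p $ k))"
      by (rule sum.mono_neutral_right) (auto simp: q_def axis_def)
    then show ?thesis using \<open>i \<noteq> j\<close> by (simp add: sum_subtractf q_def axis_def)
  qed
  have "q \<in> prob_simplex"
    unfolding prob_simplex_def
  proof (intro CollectI conjI allI)
    show "0 \<le> q $ k" for k
      using prob_simplex_nth(1)[OF pin, of k] \<epsilon> \<open>i \<noteq> j\<close> by (auto simp: q_def axis_def)
    show "(\<Sum>k\<in>UNIV. q $ k) = 1"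
      using upd[of "\<lambda>_ x. x"] prob_simplex_nth(3)[OF pin] by simp
  qed
  then have "inner p \<Theta> + inverse \<eta> * F p \<le> inner q \<Theta> + inverse \<eta> * F q"
    using choice_le p by blast
  moreover have "inner q \<Theta> = inner p \<Theta> + \<epsilon> * (\<Theta> $ i - \<Theta> $ j)"
    using \<open>i \<noteq> j\<close> by (simp add: q_def inner_add_left inner_diff_left inner_axis' algebra_simps)
  moreover have "F q = F p + (c $ i * (f (p $ i + \<epsilon>) - f (p $ i)) + c $ j * (f (p $ j - \<epsilon>) - f (p $ j)))"
    using upd[of "\<lambda>k x. c $ k * f x"] by (simp add: separable_potential_def algebra_simps)
  ultimately show ?thesis by (simp add: algebra_simps)
qed

text \<open>The slope of \<open>f\<close> tends to minus infinity at 0, so moving a little mass from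
  a positive coordinate to a vanishing one would lower the objective.\<close>

lemma choice_pos: "0 < choice \<Theta> $ i"
proof (rule ccontr)
  define p where "p = choice \<Theta>"
  have pin: "p \<in> prob_simplex" using choice_in p_def by simp
  assume "\<not> 0 < choice \<Theta> $ i"
  then have pi: "p $ i = 0" using prob_simplex_nth(1)[OF pin, of i] p_def by simp
  have "\<exists>j. p $ j \<noteq> 0" using prob_simplex_nth(3)[OF pin] by (metis sum.neutral zero_neq_one)
  then obtain j where "p $ j \<noteq> 0" by blast
  then have pj: "0 < p $ j" using prob_simplex_nth(1)[OF pin, of j] by simp
  have ij: "i \<noteq> j" using pi pj by auto
  \<comment> \<open>\<open>K\<close> is the slope at arm \<open>i\<close> below which the gain there
    outweighs the loss at arm \<open>j\<close> together with the linear term.\<close>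
  define K where "K = (c $ j * deriv f (p $ j / 2) - \<eta> * (\<Theta> $ i - \<Theta> $ j)) / c $ i"
  have "eventually (\<lambda>x. deriv f x < K) (at_right 0)"
    using legendre by (simp add: legendre_function_def filterlim_at_bot_dense)
  then obtain e where e: "0 < e" "\<And>x. 0 < x \<Longrightarrow> x < e \<Longrightarrow> deriv f x < K"
    by (auto simp: eventually_at_right_field)
  \<comment> \<open>The bound by \<open>p $ j / 2\<close> keeps arm \<open>j\<close> at half its
    mass or more, so its slope is at least \<open>deriv f (p $ j / 2)\<close> whatever \<epsilon>
    is.\<close>
  define \<epsilon> where "\<epsilon> = min (e / 2) (p $ j / 2)"
  have \<epsilon>: "0 < \<epsilon>" "\<epsilon> < e" "\<epsilon> \<le> p $ j / 2" using e pj by (auto simp: \<epsilon>_def)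
  have "f (p $ j - \<epsilon>) - f (p $ j) < - (\<epsilon> * deriv f (p $ j - \<epsilon>))"
    using f_tangent_less[of "p $ j - \<epsilon>" "p $ j"] \<epsilon> pj by (simp add: algebra_simps)
  also have "\<dots> \<le> - (\<epsilon> * deriv f (p $ j / 2))"
    using deriv_f_less[of "p $ j / 2" "p $ j - \<epsilon>"] \<epsilon> pj
    by (cases "p $ j - \<epsilon> = p $ j / 2") (auto intro!: mult_left_mono)
  finally have j: "c $ j * (f (p $ j - \<epsilon>) - f (p $ j)) \<le> - (\<epsilon> * (c $ j * deriv f (p $ j / 2)))"
    using mult_left_mono[of "f (p $ j - \<epsilon>) - f (p $ j)" "- (\<epsilon> * deriv f (p $ j / 2))" "c $ j"]
      weight_pos[of j] by (simp add: algebra_simps)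
  \<comment> \<open>Continuity at 0 suffices for the mean value theorem, which expresses the
    increment from 0 by a slope at some \<open>\<xi>\<close> below \<open>e\<close>.\<close>
  have "\<exists>\<xi>. 0 < \<xi> \<and> \<xi> < \<epsilon> \<and> f \<epsilon> - f 0 = (\<lambda>x. x * deriv f \<xi>) (\<epsilon> - 0)"
  proof (rule mvt[OF \<epsilon>(1)])
    show "continuous_on {0..\<epsilon>} f"
      using legendre by (auto simp: legendre_function_def intro: continuous_on_subset)
    show "(f has_derivative (\<lambda>x. x * deriv f \<xi>)) (at \<xi>)" if "0 < \<xi>" "\<xi> < \<epsilon>" for \<xi>
      using DERIV_f[OF that(1)] by (simp add: has_field_derivative_def mult_commute_abs)
  qed auto
  then obtain \<xi> where \<xi>: "0 < \<xi>" "\<xi> < \<epsilon>" "f \<epsilon> - f 0 = \<epsilon> * deriv f \<xi>" by auto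
  have "deriv f \<xi> < K" using e(2) \<xi> \<epsilon> by auto
  then have "c $ i * deriv f \<xi> < c $ j * deriv f (p $ j / 2) - \<eta> * (\<Theta> $ i - \<Theta> $ j)"
    using weight_pos[of i] by (simp add: K_def field_simps)
  then have "\<epsilon> * (c $ i * deriv f \<xi>) < \<epsilon> * (c $ j * deriv f (p $ j / 2) - \<eta> * (\<Theta> $ i - \<Theta> $ j))"
    using \<epsilon> by simp
  then have *: "\<epsilon> * (\<eta> * (\<Theta> $ i - \<Theta> $ j)) +
      (c $ i * (f (p $ i + \<epsilon>) - f (p $ i)) + c $ j * (f (p $ j - \<epsilon>) - f (p $ j))) < 0"
    using j \<xi>(3) by (simp add: pi algebra_simps)
  have "0 \<le> \<epsilon> * (\<Theta> $ i - \<Theta> $ j) +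
      inverse \<eta> * (c $ i * (f (p $ i + \<epsilon>) - f (p $ i)) + c $ j * (f (p $ j - \<epsilon>) - f (p $ j)))"
    using \<epsilon> pi pj ij by (intro choice_exchange p_def) auto
  also have "\<dots> = inverse \<eta> * (\<epsilon> * (\<eta> * (\<Theta> $ i - \<Theta> $ j)) +
      (c $ i * (f (p $ i + \<epsilon>) - f (p $ i)) + c $ j * (f (p $ j - \<epsilon>) - f (p $ j))))"
    using rate_pos by (simp add: field_simps)
  finally show False using * rate_pos by (simp add: zero_le_mult_iff)
qed

lemma choice_in_interior: "choice \<Theta> \<in> prob_simplex_interior"
  by (simp add: prob_simplex_interior_def choice_in choice_pos)

text \<open>All coordinates are positive, so mass can be exchanged between \<open>i\<close> and
  \<open>j\<close> in both directions and the derivative of the exchange vanishes at 0. The common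
  value is the Lagrange multiplier of the sum constraint.\<close>

lemma choice_stationary:
  "\<Theta> $ i + inverse \<eta> * (c $ i * deriv f (choice \<Theta> $ i)) =
   \<Theta> $ j + inverse \<eta> * (c $ j * deriv f (choice \<Theta> $ j))"
proof (cases "i = j")
  case False
  define p where "p = choice \<Theta>"
  have pos: "0 < p $ i" "0 < p $ j" by (simp_all add: p_def choice_pos)
  define g where "g = (\<lambda>\<epsilon>. \<epsilon> * (\<Theta> $ i - \<Theta> $ j) +
    inverse \<eta> * (c $ i * (f (p $ i + \<epsilon>) - f (p $ i)) + c $ j * (f (p $ j - \<epsilon>) - f (p $ j))))"
  have "(g has_real_derivative (\<Theta> $ i - \<Theta> $ j) +
      inverse \<eta> * (c $ i * deriv f (p $ i) - c $ j * deriv f (p $ j))) (at 0)"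
  proof -
    have "((\<lambda>\<epsilon>. f (p $ i + \<epsilon>)) has_real_derivative deriv f (p $ i + 0) * 1) (at 0)"
      by (rule DERIV_chain2[of f]) (auto intro!: derivative_eq_intros DERIV_f pos)
    moreover have "((\<lambda>\<epsilon>. f (p $ j - \<epsilon>)) has_real_derivative deriv f (p $ j - 0) * (- 1)) (at 0)"
      by (rule DERIV_chain2[of f]) (auto intro!: derivative_eq_intros DERIV_f pos)
    ultimately show ?thesis
      unfolding g_def by (auto intro!: derivative_eq_intros simp: algebra_simps)
  qed
  moreover have "g 0 \<le> g \<epsilon>" if "\<bar>0 - \<epsilon>\<bar> < min (p $ i) (p $ j)" for \<epsilon>
    using choice_exchange[OF p_def False, of \<epsilon>] that by (auto simp: g_def)
  ultimately have "(\<Theta> $ i - \<Theta> $ j) +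
      inverse \<eta> * (c $ i * deriv f (p $ i) - c $ j * deriv f (p $ j)) = 0"
    using DERIV_local_min[of g _ 0 "min (p $ i) (p $ j)"] pos by auto
  then show ?thesis by (simp add: p_def algebra_simps)
qed simp

text \<open>If arm \<open>j\<close> lost mass, then, since arm \<open>i\<close> gains none, some
  third arm \<open>k\<close> would gain. The dual values of \<open>j\<close> and \<open>k\<close>
  are unchanged, so stationarity fixes the difference of their weighted slopes, while strict
  monotonicity of \<open>deriv f\<close> moves the two slopes apart.\<close>

lemma choice_nth_mono_other:
  assumes "0 \<le> s" "j \<noteq> i"
  shows "choice \<Theta> $ j \<le> choice (\<Theta> + axis i s) $ j"
proof (rule ccontr)
  define p q where "p = choice \<Theta>" and "q = choice (\<Theta> + axis i s)"
  assume "\<not> choice \<Theta> $ j \<le> choice (\<Theta> + axis i s) $ j"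
  then have j: "q $ j < p $ j" by (simp add: p_def q_def)
  have i: "q $ i \<le> p $ i"
    using choice_nth_antimono[OF assms(1), of \<Theta> i] by (simp add: p_def q_def axis_eq_0_iff[THEN iffD2])
  have "\<exists>k. p $ k < q $ k"
  proof (rule ccontr)
    assume "\<not> (\<exists>k. p $ k < q $ k)"
    then have "(\<Sum>k\<in>UNIV. q $ k) < (\<Sum>k\<in>UNIV. p $ k)"
      using j by (intro sum_strict_mono_ex1) (auto simp: not_less)
    then show False
      using prob_simplex_nth(3)[OF choice_in] by (simp add: p_def q_def)
  qed
  then obtain k where k: "p $ k < q $ k" by blast
  have "k \<noteq> i" using i k by auto
  have "c $ j * deriv f (q $ j) < c $ j * deriv f (p $ j)"
    using deriv_f_less[OF _ j] weight_pos[of j] by (simp add: q_def choice_pos)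
  moreover have "c $ k * deriv f (p $ k) < c $ k * deriv f (q $ k)"
    using deriv_f_less[OF _ k] weight_pos[of k] by (simp add: p_def choice_pos)
  moreover have "\<Theta> $ j - \<Theta> $ k = inverse \<eta> * (c $ k * deriv f (p $ k) - c $ j * deriv f (p $ j))"
    using choice_stationary[of \<Theta> j k] by (simp add: p_def algebra_simps)
  moreover have "\<Theta> $ j - \<Theta> $ k = inverse \<eta> * (c $ k * deriv f (q $ k) - c $ j * deriv f (q $ j))"
    using choice_stationary[of "\<Theta> + axis i s" j k] assms(2) \<open>k \<noteq> i\<close>
    by (simp add: q_def axis_def algebra_simps)
  ultimately show False using rate_pos by simp
qed

section \<open>The gradient of the potential and the stability term\<close>

lemma GDERIV_separable:
  assumes "\<And>i. 0 < x $ i"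
  shows "GDERIV F x :> (\<chi> i. c $ i * deriv f (x $ i))"
proof -
  have "((\<lambda>y. f (y $ i)) has_derivative (\<lambda>h. h $ i * deriv f (x $ i))) (at x)" for i
  proof -
    have "(f has_derivative (\<lambda>h. h * deriv f (x $ i))) (at (x $ i))"
      using DERIV_f[OF assms] by (simp add: has_field_derivative_def mult_commute_abs)
    from has_derivative_compose[OF bounded_linear_imp_has_derivative[OF bounded_linear_vec_nth] this]
    show ?thesis .
  qed
  then have "((\<lambda>y. \<Sum>i\<in>UNIV. c $ i * f (y $ i)) has_derivative
      (\<lambda>h. \<Sum>i\<in>UNIV. c $ i * (h $ i * deriv f (x $ i)))) (at x)"
    by (intro has_derivative_sum has_derivative_mult_right) auto
  then show ?thesis
    unfolding gderiv_def separable_potential_def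
    by (simp add: inner_vec_def mult_ac)
qed

text \<open>At \<open>x = choice \<Theta>\<close> the scaled gradient of the potential equals \<open>- \<Theta>\<close> up to a multiple of
  the all-ones vector, and the conjugate only sees vectors modulo that direction.\<close>

lemma bregman_choice:
  "bregman conjugate (inverse \<eta> *\<^sub>R gradient F (choice \<Theta>) - v) (inverse \<eta> *\<^sub>R gradient F (choice \<Theta>)) =
   conjugate (- \<Theta> - v) - conjugate (- \<Theta>) + inner v (choice \<Theta>)"
proof -
  \<comment> \<open>Any reference arm serves: by stationarity \<kappa> is the same for all of
    them.\<close>
  define k :: 'n where "k = undefined"
  define \<kappa> where "\<kappa> = \<Theta> $ k + inverse \<eta> * (c $ k * deriv f (choice \<Theta> $ k))"
  have "inverse \<eta> *\<^sub>R gradient F (choice \<Theta>) = - \<Theta> + vec \<kappa>"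
    unfolding gradient_eqI[OF GDERIV_separable[OF choice_pos]]
    using choice_stationary[of \<Theta> _ k] by (simp add: vec_eq_iff \<kappa>_def algebra_simps)
  then have "inverse \<eta> *\<^sub>R gradient F (choice \<Theta>) - v = (- \<Theta> - v) + vec \<kappa>"
    and "inverse \<eta> *\<^sub>R gradient F (choice \<Theta>) = - \<Theta> + vec \<kappa>" by simp_all
  then have "bregman conjugate (inverse \<eta> *\<^sub>R gradient F (choice \<Theta>) - v) (inverse \<eta> *\<^sub>R gradient F (choice \<Theta>)) =
    bregman conjugate (- \<Theta> - v) (- \<Theta>)"
    by (simp only: bregman_conjugate_shift)
  then show ?thesis
    by (simp add: bregman_def gradient_conjugate inner_diff_left)
qed

text \<open>The choice is interior, hence admissible in the supremum defining \<open>stab\<close>,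
  and \<open>bregman_choice\<close> turns the divergence into conjugate values.\<close>

lemma stab_step_le:
  assumes "stab L F = ereal S" and "\<And>i. l $ i \<in> {0..L}"
  shows "(\<Sum>i\<in>UNIV. choice \<Theta> $ i * (conjugate (- \<Theta> - axis i (l $ i / choice \<Theta> $ i))
      - conjugate (- \<Theta>) + l $ i)) \<le> \<eta> * S"
proof -
  have "ereal (inverse \<eta> * (\<Sum>i\<in>UNIV. choice \<Theta> $ i *
      bregman conjugate (inverse \<eta> *\<^sub>R gradient F (choice \<Theta>) - axis i (l $ i / choice \<Theta> $ i))
        (inverse \<eta> *\<^sub>R gradient F (choice \<Theta>)))) \<le> stab L F"
    unfolding stab_def
    by (rule SUP_upper2[of \<eta>], use rate_pos in simp, rule SUP_upper2[OF choice_in_interior],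
        rule SUP_upper2[of l]) (use assms(2) in auto)
  \<comment> \<open>The importance weight cancels against the probability of the arm.\<close>
  moreover have "inner (axis i (l $ i / choice \<Theta> $ i)) (choice \<Theta>) = l $ i" for i
    using choice_pos[of \<Theta> i] by (simp add: inner_axis')
  ultimately have "inverse \<eta> * (\<Sum>i\<in>UNIV. choice \<Theta> $ i *
      (conjugate (- \<Theta> - axis i (l $ i / choice \<Theta> $ i)) - conjugate (- \<Theta>) + l $ i)) \<le> S"
    by (simp add: bregman_choice assms(1))
  then show ?thesis using rate_pos by (simp add: field_simps)
qed

end

section \<open>The hedged dynamics\<close>

text \<open>The right side is the integral of \<open>\<alpha> * x powr (\<alpha> - 2)\<close> from
  \<open>r\<close> to \<open>r'\<close>, and one factor \<open>1 / x\<close> is at least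
  \<open>1 / r'\<close> there. The derivation is algebraic, from Young's inequality for
  \<open>r'\<close> and \<open>r\<close> with weights \<alpha> and
  \<open>1 - \<alpha>\<close>.\<close>

lemma powr_increment_le:
  fixes r r' \<alpha> :: real
  assumes "0 < r" "r \<le> r'" "0 < \<alpha>" "\<alpha> < 1"
  shows "(r' powr \<alpha> - r powr \<alpha>) * inverse r' \<le> \<alpha> / (1 - \<alpha>) * (r powr (\<alpha> - 1) - r' powr (\<alpha> - 1))"
proof -
  have r': "0 < r'" using assms by simp
  have "r' powr \<alpha> * r powr (1 - \<alpha>) \<le> \<alpha> * r' + (1 - \<alpha>) * r"
    using assms r' by (intro Youngs_inequality_0) auto
  then have "r' powr \<alpha> * r powr (1 - \<alpha>) * r powr (\<alpha> - 1) \<le> (\<alpha> * r' + (1 - \<alpha>) * r) * r powr (\<alpha> - 1)"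
    by (rule mult_right_mono) simp
  also have "\<dots> = \<alpha> * r' * r powr (\<alpha> - 1) + (1 - \<alpha>) * (r * r powr (\<alpha> - 1))"
    by (simp only: distrib_right mult.assoc)
  also have "r * r powr (\<alpha> - 1) = r powr \<alpha>"
    using assms by (simp add: powr_diff)
  also have "r' powr \<alpha> * r powr (1 - \<alpha>) * r powr (\<alpha> - 1) = r' powr \<alpha>"
    using assms by (simp add: mult.assoc powr_add[symmetric])
  finally have "(1 - \<alpha>) * (r' powr \<alpha> - r powr \<alpha>) \<le> \<alpha> * (r' * r powr (\<alpha> - 1) - r' powr \<alpha>)"
    by (simp add: algebra_simps)
  then have "(1 - \<alpha>) * (r' powr \<alpha> - r powr \<alpha>) * inverse r'
      \<le> \<alpha> * (r' * r powr (\<alpha> - 1) - r' powr \<alpha>) * inverse r'"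
    by (rule mult_right_mono) (use r' in simp)
  also have "\<dots> = \<alpha> * (r powr (\<alpha> - 1) - r' powr (\<alpha> - 1))"
    using r' by (simp add: powr_diff field_simps)
  finally show ?thesis
    using assms by (simp add: field_simps)
qed

lemma powr_minus_inverse: "0 \<le> x \<Longrightarrow> x powr (- a) = inverse x powr a" for x a :: real
  by (simp add: powr_minus inverse_powr)

locale hedged_ftrl = legendre_potential c f \<eta>
  for c :: "real ^ 'n" and f :: "real \<Rightarrow> real" and \<eta> :: real +
  fixes \<alpha> R :: real
  assumes exponent: "0 < \<alpha>" "\<alpha> < 1" and bias_scale: "0 < R"
begin

text \<open>With \<open>\<Theta>\<close> the dual point after the loss and \<open>\<beta>\<close> the bias of arm \<open>i\<close>, a bonus \<open>s\<close> restores
  the hedging condition of arm \<open>i\<close> iff the deficit is nonpositive.\<close>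

definition deficit :: "real ^ 'n \<Rightarrow> real \<Rightarrow> 'n \<Rightarrow> real \<Rightarrow> real" where
  "deficit \<Theta> \<beta> i s = (choice (\<Theta> - axis i s) $ i) powr (- \<alpha>) * R - (\<beta> + s)"

text \<open>The value 0 encodes the branch without a bonus, so that both branches of a round become
  the same update of the bias.\<close>

definition bonus :: "real ^ 'n \<Rightarrow> real \<Rightarrow> 'n \<Rightarrow> real" where
  "bonus \<Theta> \<beta> i = (if deficit \<Theta> \<beta> i 0 \<le> 0 then 0 else THE b. 0 < b \<and> deficit \<Theta> \<beta> i b = 0)"

text \<open>A larger bonus cannot lower the probability of arm \<open>i\<close>, so the power term
  does not increase; strictness comes from the summand \<open>- s\<close>.\<close>

lemma deficit_less:
  assumes "s < s'"
  shows "deficit \<Theta> \<beta> i s' < deficit \<Theta> \<beta> i s"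
proof -
  have "\<Theta> - axis i x = \<Theta> + axis i (- x)" for x
    by (simp add: vec_eq_iff axis_def)
  then have "choice (\<Theta> - axis i s) $ i \<le> choice (\<Theta> - axis i s') $ i"
    using choice_nth_antimono[of "- s'" "- s" \<Theta> i] assms by (simp only:)
  then have "choice (\<Theta> - axis i s') $ i powr (- \<alpha>) \<le> choice (\<Theta> - axis i s) $ i powr (- \<alpha>)"
    using exponent choice_pos by (intro powr_mono2') auto
  then have "choice (\<Theta> - axis i s') $ i powr (- \<alpha>) * R \<le> choice (\<Theta> - axis i s) $ i powr (- \<alpha>) * R"
    using bias_scale by (intro mult_right_mono) auto
  then show ?thesis
    using assms by (simp add: deficit_def)
qed

lemma continuous_deficit: "continuous_on S (deficit \<Theta> \<beta> i)"
proof -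
  have "continuous_on S (\<lambda>s. choice (\<Theta> - axis i s))"
    by (rule continuous_on_compose2[OF continuous_choice])
       (auto intro!: continuous_intros continuous_axis)
  then have "continuous_on S (\<lambda>s. choice (\<Theta> - axis i s) $ i powr (- \<alpha>))"
    using choice_pos by (intro continuous_intros) (auto simp: less_imp_neq[symmetric])
  then show ?thesis
    unfolding deficit_def
    by (intro continuous_on_diff continuous_on_mult continuous_on_add continuous_on_const continuous_on_id)
qed

text \<open>The intermediate value theorem gives a root in the positive case and strict decrease
  makes it unique, so the definite description is meaningful. The bonus never exceeds the loss
  estimate \<open>v\<close>.\<close>

lemma bonus_cases:
  assumes "0 \<le> v" and hedged: "choice \<Theta> $ i powr (- \<alpha>) * R \<le> \<beta>"
  defines "b \<equiv> bonus (\<Theta> + axis i v) \<beta> i"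
  shows "(b = 0 \<and> deficit (\<Theta> + axis i v) \<beta> i 0 \<le> 0) \<or>
    (0 < b \<and> b \<le> v \<and> deficit (\<Theta> + axis i v) \<beta> i b = 0)"
proof (cases "deficit (\<Theta> + axis i v) \<beta> i 0 \<le> 0")
  case False
  let ?d = "deficit (\<Theta> + axis i v) \<beta> i"
  \<comment> \<open>A bonus of size \<open>v\<close> undoes the loss entirely and returns to
    \<Theta>, where the hedging condition holds.\<close>
  have "?d v \<le> 0" using assms by (simp add: deficit_def)
  then obtain x where x: "0 \<le> x" "x \<le> v" "?d x = 0"
    using IVT2'[of ?d v 0 0] False assms(1) continuous_deficit by force
  have x0: "0 < x" using x False by (cases "x = 0") auto
  have "(THE b. 0 < b \<and> ?d b = 0) = x"
  proof (rule the_equality)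
    fix b' assume "0 < b' \<and> ?d b' = 0"
    then show "b' = x"
      using x deficit_less[of x b' "\<Theta> + axis i v" \<beta> i] deficit_less[of b' x "\<Theta> + axis i v" \<beta> i]
      by (cases b' x rule: linorder_cases) auto
  qed (use x x0 in simp)
  then show ?thesis using False x x0 by (simp add: b_def bonus_def)
qed (simp add: b_def bonus_def)

text \<open>For nonnegative \<open>s\<close>, strict decrease puts \<open>s\<close> below the bonus
  exactly when the deficit at \<open>s\<close> is positive. This replaces the definite description
  by an explicit expression in the measurability proof.\<close>

lemma less_bonus_iff:
  assumes "0 \<le> v" "choice \<Theta> $ i powr (- \<alpha>) * R \<le> \<beta>"
  shows "s < bonus (\<Theta> + axis i v) \<beta> i \<longleftrightarrow> s < 0 \<or> 0 < deficit (\<Theta> + axis i v) \<beta> i s"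
  using bonus_cases[OF assms] deficit_less[of 0 s "\<Theta> + axis i v" \<beta> i]
    deficit_less[of s "bonus (\<Theta> + axis i v) \<beta> i" "\<Theta> + axis i v" \<beta> i]
    deficit_less[of "bonus (\<Theta> + axis i v) \<beta> i" s "\<Theta> + axis i v" \<beta> i]
  by (smt (verit))

section \<open>The trajectory of the algorithm in dual coordinates\<close>

definition cum_loss :: "(nat \<Rightarrow> 'n) \<Rightarrow> (nat \<Rightarrow> real) \<Rightarrow> nat \<Rightarrow> real ^ 'n" where
  "cum_loss a y t = fst (hedged_state \<eta> F \<alpha> R a y t)"

definition bias :: "(nat \<Rightarrow> 'n) \<Rightarrow> (nat \<Rightarrow> real) \<Rightarrow> nat \<Rightarrow> real ^ 'n" where
  "bias a y t = fst (snd (hedged_state \<eta> F \<alpha> R a y t))"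

text \<open>Subtracting the initial bias leaves only the bonuses granted so far, so the trajectory
  starts at 0.\<close>

definition dual :: "(nat \<Rightarrow> 'n) \<Rightarrow> (nat \<Rightarrow> real) \<Rightarrow> nat \<Rightarrow> real ^ 'n" where
  "dual a y t = cum_loss a y t - (bias a y t - init_bias F \<alpha> R)"

definition loss_estimate :: "(nat \<Rightarrow> 'n) \<Rightarrow> (nat \<Rightarrow> real) \<Rightarrow> nat \<Rightarrow> real" where
  "loss_estimate a y t = y (Suc t) / choice (dual a y t) $ a (Suc t)"

definition granted :: "(nat \<Rightarrow> 'n) \<Rightarrow> (nat \<Rightarrow> real) \<Rightarrow> nat \<Rightarrow> real" where
  "granted a y t =
     bonus (dual a y t + axis (a (Suc t)) (loss_estimate a y t)) (bias a y t $ a (Suc t)) (a (Suc t))"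

text \<open>This is the \<rho> of round \<open>t\<close>. It is meaningful from round 1 on, hence
  the recurring argument \<open>Suc t\<close>.\<close>

definition peak :: "(nat \<Rightarrow> 'n) \<Rightarrow> (nat \<Rightarrow> real) \<Rightarrow> nat \<Rightarrow> 'n \<Rightarrow> real" where
  "peak a y t j = (MAX s\<in>{1..t}. inverse (hedged_dist \<eta> F \<alpha> R a y s $ j))"

lemma cum_loss_0 [simp]: "cum_loss a y 0 = 0"
  and bias_0 [simp]: "bias a y 0 = init_bias F \<alpha> R"
  and dual_0 [simp]: "dual a y 0 = 0"
  by (simp_all add: cum_loss_def bias_def dual_def)

text \<open>Granting \<open>b\<close> to arm \<open>i\<close> subtracts \<open>axis i b\<close> from
  the dual point, so the test and the defining equation of the algorithm are both conditions on
  \<open>deficit\<close>, and the two branches merge.\<close>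

lemma hedged_state_Suc:
  assumes "hedged_state \<eta> F \<alpha> R a y t = (Lh, B, p)"
  defines "i \<equiv> a (Suc t)"
  defines "Lh' \<equiv> Lh + axis i (y (Suc t) / p $ i)"
  defines "B' \<equiv> B + axis i (bonus (Lh' - (B - init_bias F \<alpha> R)) (B $ i) i)"
  shows "hedged_state \<eta> F \<alpha> R a y (Suc t) = (Lh', B', choice (Lh' - (B' - init_bias F \<alpha> R)))"
proof -
  let ?\<Theta> = "Lh' - (B - init_bias F \<alpha> R)"
  have shift: "choice (Lh' - (B + axis i b - init_bias F \<alpha> R)) = choice (?\<Theta> - axis i b)" for b
    by (simp add: algebra_simps)
  have cond: "choice ?\<Theta> $ i powr (- \<alpha>) * R \<le> B $ i \<longleftrightarrow> deficit ?\<Theta> (B $ i) i 0 \<le> 0"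
    by (simp add: deficit_def axis_eq_0_iff[THEN iffD2, OF refl])
  have root: "choice (?\<Theta> - axis i b) $ i powr (- \<alpha>) * R = (B + axis i b) $ i \<longleftrightarrow> deficit ?\<Theta> (B $ i) i b = 0" for b
    by (auto simp: deficit_def axis_def)
  show ?thesis
  proof (cases "deficit ?\<Theta> (B $ i) i 0 \<le> 0")
    case True
    then have "B' = B" by (simp add: B'_def bonus_def)
    with True show ?thesis
      by (simp add: assms(1) Let_def flip: i_def, simp add: cond flip: Lh'_def)
  next
    case False
    then have "B' = B + axis i (THE b. 0 < b \<and> deficit ?\<Theta> (B $ i) i b = 0)"
      by (simp add: B'_def bonus_def)
    with False show ?thesis
      unfolding hedged_state.simps(2) assms(1) Let_def split_beta fst_conv snd_conv
        i_def[symmetric] Lh'_def[symmetric] shift root cond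
      by (simp add: shift)
  qed
qed

lemma hedged_dist_eq: "hedged_dist \<eta> F \<alpha> R a y (Suc t) = choice (dual a y t)"
proof (cases t)
  case 0
  then show ?thesis by (simp add: hedged_dist_def init_dist_eq_choice)
next
  case (Suc n)
  obtain Lh B p where st: "hedged_state \<eta> F \<alpha> R a y n = (Lh, B, p)" by (metis prod_cases3)
  show ?thesis
    unfolding hedged_dist_def dual_def cum_loss_def bias_def Suc diff_Suc_1 hedged_state_Suc[OF st]
    by simp
qed

lemma
  shows cum_loss_Suc: "cum_loss a y (Suc t) = cum_loss a y t + axis (a (Suc t)) (loss_estimate a y t)"
    and bias_Suc: "bias a y (Suc t) = bias a y t + axis (a (Suc t)) (granted a y t)"
proof -
  obtain Lh B p where st: "hedged_state \<eta> F \<alpha> R a y t = (Lh, B, p)" by (metis prod_cases3)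
  have Lh: "cum_loss a y t = Lh" and B: "bias a y t = B" by (simp_all add: cum_loss_def bias_def st)
  have "p = choice (dual a y t)"
    using hedged_dist_eq[of a y t] by (simp add: hedged_dist_def st)
  then have v: "loss_estimate a y t = y (Suc t) / p $ a (Suc t)" by (simp add: loss_estimate_def)
  show 1: "cum_loss a y (Suc t) = cum_loss a y t + axis (a (Suc t)) (loss_estimate a y t)"
    unfolding Lh v unfolding cum_loss_def hedged_state_Suc[OF st] by simp
  have "dual a y t + axis (a (Suc t)) (loss_estimate a y t) =
      Lh + axis (a (Suc t)) (y (Suc t) / p $ a (Suc t)) - (B - init_bias F \<alpha> R)"
    by (simp add: dual_def Lh B v)
  then show "bias a y (Suc t) = bias a y t + axis (a (Suc t)) (granted a y t)"
    unfolding granted_def B unfolding bias_def hedged_state_Suc[OF st] by simp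
qed

lemma dual_Suc:
  "dual a y (Suc t) =
     dual a y t + axis (a (Suc t)) (loss_estimate a y t) - axis (a (Suc t)) (granted a y t)"
  by (simp add: dual_def cum_loss_Suc bias_Suc)

lemma peak_1: "peak a y (Suc 0) j = init_rho F j"
  by (simp add: peak_def hedged_dist_eq init_rho_def init_dist_eq_choice)

lemma peak_Suc: "peak a y (Suc (Suc t)) j = max (peak a y (Suc t) j) (inverse (choice (dual a y (Suc t)) $ j))"
proof -
  have "{1..Suc (Suc t)} = insert (Suc (Suc t)) {1..Suc t}" by auto
  then show ?thesis unfolding peak_def by (simp add: hedged_dist_eq max.commute)
qed

lemma inverse_choice_le_peak: "inverse (choice (dual a y t) $ j) \<le> peak a y (Suc t) j"
  by (cases t) (auto simp: peak_1 peak_Suc init_rho_def init_dist_eq_choice)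

lemma peak_pos: "0 < peak a y (Suc t) j"
  using inverse_choice_le_peak[of a y t j] choice_pos[of "dual a y t" j]
  by (meson less_le_trans positive_imp_inverse_positive)

text \<open>The current inverse probability is at most its running maximum. This turns the bias
  invariant into the premise of \<open>bonus_cases\<close> for the next round.\<close>

lemma hedging_condition:
  assumes "bias a y t $ j = peak a y (Suc t) j powr \<alpha> * R"
  shows "choice (dual a y t) $ j powr (- \<alpha>) * R \<le> bias a y t $ j"
proof -
  have "inverse (choice (dual a y t) $ j) powr \<alpha> \<le> peak a y (Suc t) j powr \<alpha>"
    using inverse_choice_le_peak exponent choice_pos
    by (intro powr_mono2) (auto simp: less_imp_le)
  then show ?thesis
    using assms bias_scale choice_pos[of "dual a y t" j] by (simp add: powr_minus_inverse less_imp_le)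
qed

lemma loss_estimate_nonneg: "0 \<le> y (Suc t) \<Longrightarrow> 0 \<le> loss_estimate a y t"
  using choice_pos by (simp add: loss_estimate_def less_imp_le)

text \<open>The central invariant, by induction over rounds: bias and peak of an arm move only
  together, and only when that arm is played.\<close>

lemma bias_eq_peak:
  assumes "\<And>s. s \<in> {1..t} \<Longrightarrow> 0 \<le> y s"
  shows "bias a y t $ j = peak a y (Suc t) j powr \<alpha> * R"
  using assms
proof (induction t arbitrary: j)
  case 0
  show ?case by (simp add: peak_1 init_bias_def)
next
  case (Suc t)
  define i where "i = a (Suc t)"
  let ?v = "loss_estimate a y t" and ?b = "granted a y t" and ?p = "choice (dual a y (Suc t))"
  have IH: "bias a y t $ k = peak a y (Suc t) k powr \<alpha> * R" for k
    using Suc by auto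
  have v: "0 \<le> ?v" using Suc.prems by (intro loss_estimate_nonneg) auto
  note cases = bonus_cases[OF v hedging_condition[OF IH[of i]], folded i_def granted_def,
      unfolded i_def, folded granted_def i_def]
  have b: "0 \<le> ?b" "?b \<le> ?v" using cases v by auto
  have shift: "axis i x - axis i z = axis i (x - z)" for x z :: real
    by (simp add: vec_eq_iff axis_def)
  have dual: "dual a y (Suc t) = dual a y t + axis i (?v - ?b)"
    by (simp add: dual_Suc shift[symmetric] flip: i_def)
  have deficit: "deficit (dual a y t + axis i ?v) \<beta> i ?b = ?p $ i powr (- \<alpha>) * R - (\<beta> + ?b)" for \<beta>
    by (simp add: deficit_def dual_Suc flip: i_def)
  have inv: "?p $ i powr (- \<alpha>) = inverse (?p $ i) powr \<alpha>"
    using choice_pos by (simp add: powr_minus_inverse less_imp_le)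
  show ?case
  proof (cases "j = i")
    case False
    \<comment> \<open>The net dual increment of the played arm is nonnegative, so arm
      \<open>j\<close> loses no probability and keeps both its peak and its bias.\<close>
    have "inverse (?p $ j) \<le> inverse (choice (dual a y t) $ j)"
      using choice_nth_mono_other[OF _ False, of "?v - ?b" "dual a y t"] b choice_pos
      by (simp add: dual)
    then have "peak a y (Suc (Suc t)) j = peak a y (Suc t) j"
      using inverse_choice_le_peak[of a y t j] by (simp add: peak_Suc)
    then show ?thesis using False IH[of j] by (simp add: bias_Suc i_def axis_def)
  next
    case True
    have bias: "bias a y (Suc t) $ i = bias a y t $ i + ?b" by (simp add: bias_Suc i_def axis_def)
    from cases show ?thesis
    proof
      \<comment> \<open>Without a bonus the old bias covers the new probability, so the peak
        stays.\<close>
      assume *: "?b = 0 \<and> deficit (dual a y t + axis i ?v) (bias a y t $ i) i 0 \<le> 0"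
      then have "inverse (?p $ i) powr \<alpha> * R \<le> peak a y (Suc t) i powr \<alpha> * R"
        using deficit[of "bias a y t $ i"] inv IH[of i] by simp
      then have "inverse (?p $ i) powr \<alpha> \<le> peak a y (Suc t) i powr \<alpha>"
        using bias_scale by simp
      then have "inverse (?p $ i) \<le> peak a y (Suc t) i"
        using exponent peak_pos[of a y t i] powr_less_mono2[of \<alpha> "peak a y (Suc t) i" "inverse (?p $ i)"]
        by (force simp: not_less[symmetric])
      then show ?thesis using * True bias IH[of i] by (simp add: peak_Suc)
    next
      \<comment> \<open>A positive bonus means that the new inverse probability exceeds the old peak
        and replaces it; the equation defining the bonus is then the invariant.\<close>
      assume *: "0 < ?b \<and> ?b \<le> ?v \<and> deficit (dual a y t + axis i ?v) (bias a y t $ i) i ?b = 0"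
      then have eq: "inverse (?p $ i) powr \<alpha> * R = bias a y t $ i + ?b"
        using deficit[of "bias a y t $ i"] inv by simp
      then have "peak a y (Suc t) i powr \<alpha> * R < inverse (?p $ i) powr \<alpha> * R"
        using * IH[of i] by simp
      then have "peak a y (Suc t) i powr \<alpha> < inverse (?p $ i) powr \<alpha>"
        using bias_scale by simp
      then have "peak a y (Suc t) i \<le> inverse (?p $ i)"
        using exponent choice_pos[of "dual a y (Suc t)" i]
          powr_mono2[of \<alpha> "inverse (?p $ i)" "peak a y (Suc t) i"]
        by (force simp: not_less[symmetric] less_imp_le)
      then show ?thesis using True bias eq by (simp add: peak_Suc)
    qed
  qed
qed

text \<open>Where a positive bonus is granted, the defining equation and the bias invariant equate
  two \<alpha>-th powers. The new probability is therefore the smallest so far, which is what makes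
  the bonus cheap.\<close>

lemma granted_cases:
  assumes "\<And>s. s \<in> {1..Suc t} \<Longrightarrow> 0 \<le> y s"
  shows "granted a y t = 0 \<or>
    0 < granted a y t \<and> granted a y t \<le> loss_estimate a y t \<and>
      choice (dual a y (Suc t)) $ a (Suc t) = inverse (peak a y (Suc (Suc t)) (a (Suc t)))"
proof -
  let ?i = "a (Suc t)" and ?p = "choice (dual a y (Suc t))"
  have v: "0 \<le> loss_estimate a y t" using assms by (intro loss_estimate_nonneg) auto
  have bias: "bias a y t $ ?i = peak a y (Suc t) ?i powr \<alpha> * R"
    and bias': "bias a y (Suc t) $ ?i = peak a y (Suc (Suc t)) ?i powr \<alpha> * R"
    using assms by (auto intro!: bias_eq_peak)
  have "inverse (?p $ ?i) = peak a y (Suc (Suc t)) ?i"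
    if "deficit (dual a y t + axis ?i (loss_estimate a y t)) (bias a y t $ ?i) ?i (granted a y t) = 0"
  proof -
    have "inverse (?p $ ?i) powr \<alpha> * R = bias a y (Suc t) $ ?i"
      using that choice_pos[of "dual a y (Suc t)" ?i]
      by (simp add: deficit_def bias_Suc dual_Suc powr_minus_inverse less_imp_le axis_def)
    then have "inverse (?p $ ?i) powr \<alpha> = peak a y (Suc (Suc t)) ?i powr \<alpha>"
      using bias' bias_scale by simp
    then have "(inverse (?p $ ?i) powr \<alpha>) powr (1 / \<alpha>) = (peak a y (Suc (Suc t)) ?i powr \<alpha>) powr (1 / \<alpha>)"
      by (rule arg_cong)
    then show ?thesis
      using exponent choice_pos[of "dual a y (Suc t)" ?i] peak_pos[of a y "Suc t" ?i]
      by (simp add: powr_powr less_imp_le)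
  qed
  then have "?p $ ?i = inverse (peak a y (Suc (Suc t)) ?i)"
    if "deficit (dual a y t + axis ?i (loss_estimate a y t)) (bias a y t $ ?i) ?i (granted a y t) = 0"
    using that by (metis inverse_inverse_eq)
  with bonus_cases[OF v hedging_condition[OF bias]] show ?thesis
    unfolding granted_def[symmetric] by blast
qed

section \<open>The pathwise regret bound\<close>

definition stab_gap :: "real ^ 'n \<Rightarrow> 'n \<Rightarrow> real \<Rightarrow> real" where
  "stab_gap \<Theta> i l = conjugate (- \<Theta> - axis i (l / choice \<Theta> $ i)) - conjugate (- \<Theta>) + l"

lemma peak_mono: "peak a y (Suc t) j \<le> peak a y (Suc (Suc t)) j"
  by (simp add: peak_Suc)

lemma peak_powr_antimono:
  "peak a y (Suc (Suc t)) j powr (\<alpha> - 1) \<le> peak a y (Suc t) j powr (\<alpha> - 1)"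
  using peak_pos peak_mono exponent by (intro powr_mono2') auto

text \<open>By the invariant the bonus is an increment of \<open>R\<close> times the \<alpha>-th
  power of the peak, and it is paid at the inverse of the new peak, so
  \<open>powr_increment_le\<close> applies.\<close>

lemma granted_cost_le:
  fixes a :: "nat \<Rightarrow> 'n"
  assumes "\<And>s. s \<in> {1..Suc t} \<Longrightarrow> 0 \<le> y s"
  defines "i \<equiv> a (Suc t)"
  shows "granted a y t * choice (dual a y (Suc t)) $ i \<le>
    \<alpha> / (1 - \<alpha>) * R * (peak a y (Suc t) i powr (\<alpha> - 1) - peak a y (Suc (Suc t)) i powr (\<alpha> - 1))"
proof -
  let ?r = "peak a y (Suc t) i" and ?r' = "peak a y (Suc (Suc t)) i"
  from granted_cases[of t y a, OF assms(1)] show ?thesis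
  proof
    assume "granted a y t = 0"
    then show ?thesis using exponent bias_scale peak_powr_antimono[of a y t i] by simp
  next
    assume *: "0 < granted a y t \<and> granted a y t \<le> loss_estimate a y t \<and>
      choice (dual a y (Suc t)) $ a (Suc t) = inverse (peak a y (Suc (Suc t)) (a (Suc t)))"
    have "bias a y t $ i = ?r powr \<alpha> * R" "bias a y (Suc t) $ i = ?r' powr \<alpha> * R"
      using assms by (auto intro!: bias_eq_peak)
    then have "granted a y t = (?r' powr \<alpha> - ?r powr \<alpha>) * R"
      by (simp add: bias_Suc i_def axis_def algebra_simps)
    then have "granted a y t * choice (dual a y (Suc t)) $ i = R * ((?r' powr \<alpha> - ?r powr \<alpha>) * inverse ?r')"
      using * by (simp add: i_def)
    also have "\<dots> \<le> R * (\<alpha> / (1 - \<alpha>) * (?r powr (\<alpha> - 1) - ?r' powr (\<alpha> - 1)))"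
      using bias_scale exponent
      by (intro mult_left_mono powr_increment_le peak_pos peak_mono) auto
    finally show ?thesis by (simp add: mult_ac)
  qed
qed

text \<open>By \<open>bregman_choice\<close>, \<open>stab_gap\<close> is the divergence occurring in
  \<open>stab\<close> for one drawn arm. It is the error of the linear prediction that the conjugate
  drops by the observed loss.\<close>

lemma conjugate_loss_step:
  "conjugate (- (dual a y t + axis (a (Suc t)) (loss_estimate a y t))) =
     conjugate (- dual a y t) + stab_gap (dual a y t) (a (Suc t)) (y (Suc t)) - y (Suc t)"
  by (simp add: stab_gap_def loss_estimate_def)

text \<open>Each round splits into the loss, which contributes the gap minus the observed loss, and
  the bonus, whose cost telescopes in the peaks.\<close>

lemma conjugate_dual_le:
  assumes "\<And>s. s \<in> {1..t} \<Longrightarrow> 0 \<le> y s"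
  shows "conjugate (- dual a y t) - conjugate 0 \<le>
    (\<Sum>s<t. stab_gap (dual a y s) (a (Suc s)) (y (Suc s)) - y (Suc s)) +
    \<alpha> / (1 - \<alpha>) * R * (\<Sum>j\<in>UNIV. init_rho F j powr (\<alpha> - 1) - peak a y (Suc t) j powr (\<alpha> - 1))"
  using assms
proof (induction t)
  case 0
  show ?case by (simp add: peak_1)
next
  case (Suc t)
  define i where "i = a (Suc t)"
  let ?w = "dual a y t + axis i (loss_estimate a y t)"
  let ?\<Delta> = "\<lambda>j. peak a y (Suc t) j powr (\<alpha> - 1) - peak a y (Suc (Suc t)) j powr (\<alpha> - 1)"
  \<comment> \<open>The subgradient is taken at the point after the bonus, so the bonus is priced at
    the new probability.\<close>
  have "conjugate (- dual a y (Suc t)) + inner (choice (dual a y (Suc t))) (- ?w + dual a y (Suc t)) \<le> conjugate (- ?w)"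
    using conjugate_subgradient[of "- dual a y (Suc t)" "- ?w"] by simp
  moreover have "- ?w + dual a y (Suc t) = - axis i (granted a y t)"
    by (simp add: dual_Suc i_def)
  ultimately have 1: "conjugate (- dual a y (Suc t)) \<le>
      conjugate (- ?w) + granted a y t * choice (dual a y (Suc t)) $ i"
    by (simp add: inner_axis mult.commute)
  have 2: "granted a y t * choice (dual a y (Suc t)) $ i \<le> \<alpha> / (1 - \<alpha>) * R * ?\<Delta> i"
    unfolding i_def using Suc.prems by (intro granted_cost_le) auto
  \<comment> \<open>Only arm \<open>i\<close> is charged, but all terms are nonnegative; the sum
    over all arms telescopes across rounds.\<close>
  have "?\<Delta> i \<le> (\<Sum>j\<in>UNIV. ?\<Delta> j)"
    using peak_powr_antimono by (intro member_le_sum) auto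
  then have 3: "\<alpha> / (1 - \<alpha>) * R * ?\<Delta> i \<le> \<alpha> / (1 - \<alpha>) * R * (\<Sum>j\<in>UNIV. ?\<Delta> j)"
    using exponent bias_scale by (intro mult_left_mono) auto
  have IH: "conjugate (- dual a y t) - conjugate 0 \<le>
    (\<Sum>s<t. stab_gap (dual a y s) (a (Suc s)) (y (Suc s)) - y (Suc s)) +
    \<alpha> / (1 - \<alpha>) * R * (\<Sum>j\<in>UNIV. init_rho F j powr (\<alpha> - 1) - peak a y (Suc t) j powr (\<alpha> - 1))"
    using Suc by auto
  have 4: "(\<Sum>j\<in>UNIV. init_rho F j powr (\<alpha> - 1) - peak a y (Suc (Suc t)) j powr (\<alpha> - 1)) =
    (\<Sum>j\<in>UNIV. init_rho F j powr (\<alpha> - 1) - peak a y (Suc t) j powr (\<alpha> - 1)) + (\<Sum>j\<in>UNIV. ?\<Delta> j)"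
    by (simp add: sum.distrib[symmetric])
  show ?case
    using 1 2 3 IH conjugate_loss_step[of a y t]
    unfolding 4 distrib_left i_def sum.lessThan_Suc by linarith
qed

text \<open>The bonus of the last round is never used, so the final comparison takes place before it is
  granted; this is why the peaks enter up to round \<open>Suc t\<close> and not one round later.\<close>

lemma pathwise_regret:
  assumes "\<And>s. s \<in> {1..t} \<Longrightarrow> 0 \<le> y s"
    and diam: "F (axis k 1) - F (init_dist F) \<le> D"
  shows "(\<Sum>s<Suc t. y (Suc s)) - cum_loss a y (Suc t) $ k \<le>
    D / \<eta> + (\<Sum>s<Suc t. stab_gap (dual a y s) (a (Suc s)) (y (Suc s))) +
    (\<alpha> / (1 - \<alpha>) * (\<Sum>j\<in>UNIV. init_rho F j powr (\<alpha> - 1) - peak a y (Suc t) j powr (\<alpha> - 1)) +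
      init_rho F k powr \<alpha> - peak a y (Suc t) k powr \<alpha>) * R"
proof -
  let ?w = "dual a y t + axis (a (Suc t)) (loss_estimate a y t)"
  have "?w = cum_loss a y (Suc t) - (bias a y t - init_bias F \<alpha> R)"
    by (simp add: dual_def cum_loss_Suc)
  then have w: "?w $ k = cum_loss a y (Suc t) $ k - (peak a y (Suc t) k powr \<alpha> - init_rho F k powr \<alpha>) * R"
    using bias_eq_peak[of t y a k, OF assms(1)] by (simp add: init_bias_def left_diff_distrib)
  \<comment> \<open>The comparator is the vertex of arm \<open>k\<close>, which bounds the final
    conjugate from below.\<close>
  have "inner (axis k 1) (- ?w) - inverse \<eta> * F (axis k 1) \<le> conjugate (- ?w)"
    by (rule conjugate_ge[OF axis_in_prob_simplex])
  then have "- (?w $ k) - inverse \<eta> * F (axis k 1) \<le> conjugate (- ?w)"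
    by (simp add: inner_axis' inner_minus_right)
  moreover have "conjugate 0 = - (inverse \<eta> * F (init_dist F))"
    by (simp add: conjugate_eq init_dist_eq_choice)
  moreover have "inverse \<eta> * (F (axis k 1) - F (init_dist F)) \<le> D / \<eta>"
    using mult_left_mono[OF diam, of "inverse \<eta>"] rate_pos by (simp add: divide_inverse mult.commute)
  ultimately have "- (?w $ k) - D / \<eta> \<le> conjugate (- ?w) - conjugate 0"
    by (simp add: right_diff_distrib)
  then show ?thesis
    using conjugate_dual_le[of t y a, OF assms(1)] conjugate_loss_step[of a y t] w
    by (simp add: sum_subtractf algebra_simps)
qed

section \<open>Deterministic bounds valid along all trajectories\<close>

lemma stab_gap_bounded:
  assumes "0 \<le> l" "l \<le> L" "0 < \<epsilon>" "\<epsilon> \<le> choice \<Theta> $ i"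
  shows "\<bar>stab_gap \<Theta> i l\<bar> \<le> L / \<epsilon> + L"
proof -
  have "\<bar>conjugate (- \<Theta> - axis i (l / choice \<Theta> $ i)) - conjugate (- \<Theta>)\<bar> \<le> l / choice \<Theta> $ i"
    using conjugate_lipschitz[of "- \<Theta> - axis i (l / choice \<Theta> $ i)" "- \<Theta>"] assms
    by (simp add: norm_axis)
  also have "\<dots> \<le> L / \<epsilon>" using assms by (intro frac_le) auto
  finally show ?thesis using assms by (simp add: stab_gap_def)
qed

text \<open>Each coordinate is continuous and positive, so it has a positive minimum on a closed
  ball; there are finitely many arms.\<close>

lemma choice_bounded_below: "\<exists>\<epsilon>>0. \<forall>\<Theta> i. norm \<Theta> \<le> C \<longrightarrow> \<epsilon> \<le> choice \<Theta> $ i"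
proof (cases "0 \<le> C")
  case True
  have "\<exists>\<epsilon>>0. \<forall>\<Theta>. norm \<Theta> \<le> C \<longrightarrow> \<epsilon> \<le> choice \<Theta> $ i" for i
  proof -
    have "continuous_on (cball 0 C) (\<lambda>\<Theta>. choice \<Theta> $ i)"
      by (intro continuous_intros continuous_on_subset[OF continuous_choice]) auto
    then obtain \<Theta>0 where "\<forall>\<Theta>\<in>cball 0 C. choice \<Theta>0 $ i \<le> choice \<Theta> $ i"
      using continuous_attains_inf[OF compact_cball] True by (metis cball_eq_empty not_less)
    then show ?thesis using choice_pos[of \<Theta>0 i] by (intro exI[of _ "choice \<Theta>0 $ i"]) auto
  qed
  then obtain e where e: "\<And>i. 0 < e i" "\<And>i \<Theta>. norm \<Theta> \<le> C \<Longrightarrow> e i \<le> choice \<Theta> $ i" by metis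
  have "Min (range e) \<le> choice \<Theta> $ i" if "norm \<Theta> \<le> C" for \<Theta> i
    by (rule order_trans[OF Min_le e(2)[OF that]]) auto
  moreover have "0 < Min (range e)" using e(1) by simp
  ultimately show ?thesis by blast
next
  case False
  then have "\<not> norm \<Theta> \<le> C" for \<Theta> :: "real ^ 'n" using norm_ge_zero[of \<Theta>] by linarith
  then show ?thesis by (intro exI[of _ 1]) simp
qed

text \<open>A bound on the earlier dual points keeps their probabilities above some \<epsilon>,
  hence the next estimate below \<open>\<bar>L\<bar> / \<epsilon>\<close>. The bonus lies between 0
  and the estimate, so the step is no longer than the estimate. The constant precedes arms and
  losses in the quantifiers, hence is deterministic.\<close>

lemma dual_bounded:
  "\<exists>C. \<forall>a y. (\<forall>s\<in>{1..n}. y s \<in> {0..L}) \<longrightarrow> (\<forall>t\<le>n. norm (dual a y t) \<le> C)"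
proof (induction n)
  case 0
  show ?case by (intro exI[of _ 0]) simp
next
  case (Suc n)
  then obtain C where C: "\<And>a y t. (\<forall>s\<in>{1..n}. y s \<in> {0..L}) \<Longrightarrow> t \<le> n \<Longrightarrow> norm (dual a y t) \<le> C"
    by blast
  obtain \<epsilon> where \<epsilon>: "0 < \<epsilon>" "\<And>\<Theta> i. norm \<Theta> \<le> C \<Longrightarrow> \<epsilon> \<le> choice \<Theta> $ i"
    using choice_bounded_below[of C] by blast
  have "norm (dual a y t) \<le> C + \<bar>L\<bar> / \<epsilon>" if y: "\<forall>s\<in>{1..Suc n}. y s \<in> {0..L}" and t: "t \<le> Suc n" for a y t
  proof (cases "t = Suc n")
    case False
    then have "norm (dual a y t) \<le> C" using C y t by auto
    also have "\<dots> \<le> C + \<bar>L\<bar> / \<epsilon>" using \<epsilon> by simp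
    finally show ?thesis .
  next
    case True
    have dual: "norm (dual a y n) \<le> C" using C y by auto
    have yn: "0 \<le> y (Suc n)" "y (Suc n) \<le> L" using y by auto
    then have v: "0 \<le> loss_estimate a y n" "loss_estimate a y n \<le> \<bar>L\<bar> / \<epsilon>"
      using \<epsilon> dual unfolding loss_estimate_def
      by (auto intro!: loss_estimate_nonneg[unfolded loss_estimate_def] frac_le)
    have b: "0 \<le> granted a y n" "granted a y n \<le> loss_estimate a y n"
      using granted_cases[of n y a] y v by auto
    have "axis i x - axis i z = axis i (x - z)" for i :: 'n and x z :: real
      by (simp add: vec_eq_iff axis_def)
    then have "norm (dual a y (Suc n)) \<le> norm (dual a y n) + \<bar>loss_estimate a y n - granted a y n\<bar>"
      using norm_triangle_ineq[of "dual a y n" "axis (a (Suc n)) (loss_estimate a y n - granted a y n)"]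
      by (simp add: dual_Suc add_diff_eq[symmetric] norm_axis)
    then show ?thesis using dual v b True by simp
  qed
  then show ?case by blast
qed

lemma peak_bounds:
  assumes "0 < \<epsilon>" "\<And>s. s \<le> t \<Longrightarrow> \<epsilon> \<le> choice (dual a y s) $ j"
  shows "init_rho F j \<le> peak a y (Suc t) j" "peak a y (Suc t) j \<le> inverse \<epsilon>"
proof -
  show "init_rho F j \<le> peak a y (Suc t) j"
    by (induction t) (simp_all add: peak_1 peak_Suc le_max_iff_disj)
  show "peak a y (Suc t) j \<le> inverse \<epsilon>"
    using assms(2)
  proof (induction t)
    case 0
    then show ?case
      using assms(1) by (auto simp: peak_1 init_rho_def init_dist_eq_choice intro!: le_imp_inverse_le)
  next
    case (Suc t)
    have "inverse (choice (dual a y (Suc t)) $ j) \<le> inverse \<epsilon>"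
      using assms(1) Suc.prems by (intro le_imp_inverse_le) auto
    moreover have "peak a y (Suc t) j \<le> inverse \<epsilon>" using Suc by auto
    ultimately show ?case by (simp add: peak_Suc)
  qed
qed

lemma cum_loss_eq_sum: "cum_loss a y t $ k = (\<Sum>s<t. if a (Suc s) = k then loss_estimate a y s else 0)"
  by (induction t) (auto simp: cum_loss_Suc axis_def)

section \<open>Measurability of the trajectory\<close>

lemma measurable_choice [measurable]: "choice \<in> borel_measurable borel"
  by (rule borel_measurable_continuous_onI[OF continuous_choice])

lemma measurable_conjugate [measurable]: "conjugate \<in> borel_measurable borel"
  by (rule borel_measurable_continuous_onI[OF continuous_conjugate])

text \<open>The bonus is only given by a definite description, but by monotonicity its superlevel sets are
  those of the explicit deficit.\<close>

lemma measurable_bonus: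
  assumes [measurable]: "\<Theta> \<in> borel_measurable N" "\<beta> \<in> borel_measurable N" "v \<in> borel_measurable N"
    and "\<And>\<omega>. \<omega> \<in> space N \<Longrightarrow> 0 \<le> v \<omega>"
    and "\<And>\<omega>. \<omega> \<in> space N \<Longrightarrow> choice (\<Theta> \<omega>) $ i powr (- \<alpha>) * R \<le> \<beta> \<omega>"
  shows "(\<lambda>\<omega>. bonus (\<Theta> \<omega> + axis i (v \<omega>)) (\<beta> \<omega>) i) \<in> borel_measurable N"
proof (unfold borel_measurable_iff_greater, intro allI)
  fix s
  have "{\<omega> \<in> space N. s < bonus (\<Theta> \<omega> + axis i (v \<omega>)) (\<beta> \<omega>) i} =
      {\<omega> \<in> space N. s < 0 \<or> 0 < deficit (\<Theta> \<omega> + axis i (v \<omega>)) (\<beta> \<omega>) i s}"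
    using less_bonus_iff assms(4,5) by blast
  also have "\<dots> \<in> sets N"
    unfolding deficit_def by measurable
  finally show "{\<omega> \<in> space N. s < bonus (\<Theta> \<omega> + axis i (v \<omega>)) (\<beta> \<omega>) i} \<in> sets N" .
qed

text \<open>Dual point and bias are treated jointly because each bonus depends on both. The measure
  \<open>N\<close> is arbitrary so that members of the filtration can be inserted.\<close>

lemma measurable_dual_bias:
  assumes "\<And>s. s \<in> {1..t} \<Longrightarrow> A s \<in> measurable N (count_space UNIV)"
    and "\<And>s. s \<in> {1..t} \<Longrightarrow> l s \<in> borel_measurable N"
    and "\<And>s \<omega> i. s \<in> {1..t} \<Longrightarrow> \<omega> \<in> space N \<Longrightarrow> 0 \<le> l s \<omega> $ i"
  shows "(\<lambda>\<omega>. dual (\<lambda>s. A s \<omega>) (\<lambda>s. l s \<omega> $ A s \<omega>) t) \<in> borel_measurable N \<and>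
    (\<lambda>\<omega>. bias (\<lambda>s. A s \<omega>) (\<lambda>s. l s \<omega> $ A s \<omega>) t) \<in> borel_measurable N"
  using assms
proof (induction t)
  case 0
  show ?case by simp
next
  case (Suc t)
  let ?a = "\<lambda>\<omega> s. A s \<omega>" and ?y = "\<lambda>\<omega> s. l s \<omega> $ A s \<omega>"
  define \<Theta> where "\<Theta> \<omega> = dual (?a \<omega>) (?y \<omega>) t" for \<omega>
  define \<beta> where "\<beta> \<omega> = bias (?a \<omega>) (?y \<omega>) t" for \<omega>
  \<comment> \<open>Estimate and bonus are formed for every fixed arm, played or not; composing with
    the random arm is then measurable, as there are finitely many arms.\<close>
  define v where "v i \<omega> = l (Suc t) \<omega> $ i / choice (\<Theta> \<omega>) $ i" for i \<omega>
  define b where "b i \<omega> = bonus (\<Theta> \<omega> + axis i (v i \<omega>)) (\<beta> \<omega> $ i) i" for i \<omega>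
  have [measurable]: "\<Theta> \<in> borel_measurable N" "\<beta> \<in> borel_measurable N"
    unfolding \<Theta>_def \<beta>_def using Suc by auto
  have [measurable]: "A (Suc t) \<in> measurable N (count_space UNIV)" "l (Suc t) \<in> borel_measurable N"
    using Suc.prems by auto
  have [measurable]: "v i \<in> borel_measurable N" for i
    unfolding v_def by measurable
  have [measurable]: "b i \<in> borel_measurable N" for i
    unfolding b_def
  proof (rule measurable_bonus)
    fix \<omega> assume \<omega>: "\<omega> \<in> space N"
    show "0 \<le> v i \<omega>" using Suc.prems(3)[OF _ \<omega>] choice_pos by (simp add: v_def less_imp_le)
    have "bias (?a \<omega>) (?y \<omega>) t $ i = peak (?a \<omega>) (?y \<omega>) (Suc t) i powr \<alpha> * R"
      using Suc.prems(3)[OF _ \<omega>] by (intro bias_eq_peak) auto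
    then show "choice (\<Theta> \<omega>) $ i powr (- \<alpha>) * R \<le> \<beta> \<omega> $ i"
      unfolding \<Theta>_def \<beta>_def by (rule hedging_condition)
  qed measurable
  have dual: "dual (?a \<omega>) (?y \<omega>) (Suc t) = \<Theta> \<omega> + axis (A (Suc t) \<omega>) (v (A (Suc t) \<omega>) \<omega>) - axis (A (Suc t) \<omega>) (b (A (Suc t) \<omega>) \<omega>)"
    and bias: "bias (?a \<omega>) (?y \<omega>) (Suc t) = \<beta> \<omega> + axis (A (Suc t) \<omega>) (b (A (Suc t) \<omega>) \<omega>)" for \<omega>
    by (simp_all add: dual_Suc bias_Suc \<Theta>_def \<beta>_def v_def b_def granted_def loss_estimate_def)
  note compose = measurable_compose_countable'[where I = UNIV and g = "A (Suc t)"]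
  have 1: "(\<lambda>\<omega>. \<Theta> \<omega> + axis i (v i \<omega>) - axis i (b i \<omega>)) \<in> borel_measurable N"
    and 2: "(\<lambda>\<omega>. \<beta> \<omega> + axis i (b i \<omega>)) \<in> borel_measurable N" for i
    by measurable
  show ?case
    unfolding dual bias using compose[OF 1] compose[OF 2] by simp
qed

end

section \<open>Expected regret\<close>

context bandit_interaction
begin

text \<open>The value at the random arm is split by indicators of the arm. Each \<open>X i\<close>
  is known before the draw and moves into the conditional expectation, where \<open>arm_law\<close>
  supplies the probability.\<close>

lemma integral_at_arm:
  fixes X :: "'n \<Rightarrow> 'w \<Rightarrow> real"
  assumes t: "t \<in> {1..T}"
    and X [measurable]: "\<And>i. X i \<in> borel_measurable (G t)"
    and K: "\<And>i. \<forall>\<omega>\<in>space M. \<bar>X i \<omega>\<bar> \<le> K"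
    and p [measurable]: "\<And>i. (\<lambda>\<omega>. p t \<omega> $ i) \<in> borel_measurable (G t)"
  shows "integrable M (\<lambda>\<omega>. X (A t \<omega>) \<omega>)"
    and "integrable M (\<lambda>\<omega>. \<Sum>i\<in>UNIV. p t \<omega> $ i * X i \<omega>)"
    and "(\<integral>\<omega>. X (A t \<omega>) \<omega> \<partial>M) = (\<integral>\<omega>. (\<Sum>i\<in>UNIV. p t \<omega> $ i * X i \<omega>) \<partial>M)"
proof -
  interpret S: finite_measure_subalgebra M "G t"
    by unfold_locales (rule subalgebra)
  let ?I = "\<lambda>i. indicat_real {\<omega> \<in> space M. A t \<omega> = i}"
  have [measurable]: "A t \<in> measurable M (count_space UNIV)"
    by (rule measurable_from_subalg[OF subalgebra arm_measurable[OF t]])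
  have XM [measurable]: "X i \<in> borel_measurable M" for i
    by (rule measurable_from_subalg[OF subalgebra X])
  have pM [measurable]: "(\<lambda>\<omega>. p t \<omega> $ i) \<in> borel_measurable M" for i
    by (rule measurable_from_subalg[OF subalgebra p])
  have int: "integrable M (\<lambda>\<omega>. X i \<omega> * ?I i \<omega>)" for i
  proof (rule integrable_const_bound[where B = K])
    show "AE \<omega> in M. norm (X i \<omega> * ?I i \<omega>) \<le> K"
    proof (rule AE_I2)
      fix \<omega> assume "\<omega> \<in> space M"
      then show "norm (X i \<omega> * ?I i \<omega>) \<le> K"
        using K[of i] by (auto simp: indicator_def abs_mult)
    qed
  qed measurable
  have sum: "X (A t \<omega>) \<omega> = (\<Sum>i\<in>UNIV. X i \<omega> * ?I i \<omega>)" if "\<omega> \<in> space M" for \<omega>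
  proof -
    have "(\<Sum>i\<in>UNIV. X i \<omega> * ?I i \<omega>) = (\<Sum>i\<in>UNIV. if i = A t \<omega> then X i \<omega> else 0)"
      using that by (intro sum.cong) (auto simp: indicator_def)
    then show ?thesis by simp
  qed
  have AE: "AE \<omega> in M. X i \<omega> * real_cond_exp M (G t) (?I i) \<omega> = p t \<omega> $ i * X i \<omega>" for i
    using arm_law[OF t, of i] by eventually_elim simp
  have ce: "integrable M (\<lambda>\<omega>. X i \<omega> * real_cond_exp M (G t) (?I i) \<omega>)"
    "(\<integral>\<omega>. X i \<omega> * real_cond_exp M (G t) (?I i) \<omega> \<partial>M) = (\<integral>\<omega>. X i \<omega> * ?I i \<omega> \<partial>M)" for i
    using S.real_cond_exp_intg[OF int[of i] X] by measurable
  have intp: "integrable M (\<lambda>\<omega>. p t \<omega> $ i * X i \<omega>)" for i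
    using ce(1)[of i] AE[of i] by (subst integrable_cong_AE[symmetric]) auto
  have intp_eq: "(\<integral>\<omega>. p t \<omega> $ i * X i \<omega> \<partial>M) = (\<integral>\<omega>. X i \<omega> * ?I i \<omega> \<partial>M)" for i
    unfolding ce(2)[of i, symmetric]
    by (rule integral_cong_AE) (use AE[of i] in \<open>auto elim: AE_mp\<close>)
  show "integrable M (\<lambda>\<omega>. X (A t \<omega>) \<omega>)"
    by (rule iffD1[OF Bochner_Integration.integrable_cong[OF refl sum[symmetric]]])
       (use int in \<open>auto simp del: sum_indicator_mult sum_mult_indicator intro!: Bochner_Integration.integrable_sum\<close>)
  show "integrable M (\<lambda>\<omega>. \<Sum>i\<in>UNIV. p t \<omega> $ i * X i \<omega>)"
    using intp by simp
  have "(\<integral>\<omega>. X (A t \<omega>) \<omega> \<partial>M) = (\<integral>\<omega>. (\<Sum>i\<in>UNIV. X i \<omega> * ?I i \<omega>) \<partial>M)"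
    by (rule Bochner_Integration.integral_cong[OF refl sum])
  also have "\<dots> = (\<Sum>i\<in>UNIV. \<integral>\<omega>. X i \<omega> * ?I i \<omega> \<partial>M)"
    by (rule Bochner_Integration.integral_sum[OF int])
  finally show "(\<integral>\<omega>. X (A t \<omega>) \<omega> \<partial>M) = (\<integral>\<omega>. (\<Sum>i\<in>UNIV. p t \<omega> $ i * X i \<omega>) \<partial>M)"
    using intp by (simp add: intp_eq)
qed

end

context hedged_ftrl
begin

text \<open>Integrates \<open>pathwise_regret\<close> over \<open>Suc n\<close> rounds: conditioning
  on the information before each draw bounds the mean gap by \<open>\<eta> * S\<close> and turns the
  estimated loss of arm \<open>k\<close> into its true loss.\<close>

lemma expected_regret:
  fixes M :: "'w measure" and G :: "nat \<Rightarrow> 'w measure"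
    and loss :: "nat \<Rightarrow> 'w \<Rightarrow> real ^ 'n" and A :: "nat \<Rightarrow> 'w \<Rightarrow> 'n" and k :: 'n
  defines "a \<equiv> (\<lambda>\<omega> s. A s \<omega>)" and "y \<equiv> (\<lambda>\<omega> s. loss s \<omega> $ A s \<omega>)"
  assumes bandit: "bandit_interaction M G (Suc n) L loss A (\<lambda>t \<omega>. hedged_dist \<eta> F \<alpha> R (a \<omega>) (y \<omega>) t)"
    and stab: "stab L F = ereal S"
    and diam: "F (axis k 1) - F (init_dist F) \<le> D"
  shows "(\<integral>\<omega>. (\<Sum>t\<in>{1..Suc n}. loss t \<omega> $ A t \<omega> - loss t \<omega> $ k) \<partial>M) \<le>
    D / \<eta> + real (Suc n) * (\<eta> * S) +
    (\<alpha> / (1 - \<alpha>) * (\<Sum>i\<in>UNIV. init_rho F i powr (\<alpha> - 1) -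
        (\<integral>\<omega>. peak (a \<omega>) (y \<omega>) (Suc n) i powr (\<alpha> - 1) \<partial>M)) +
      init_rho F k powr \<alpha> - (\<integral>\<omega>. peak (a \<omega>) (y \<omega>) (Suc n) k powr \<alpha> \<partial>M)) * R"
proof -
  let ?p = "\<lambda>t \<omega>. hedged_dist \<eta> F \<alpha> R (a \<omega>) (y \<omega>) t"
  interpret B: bandit_interaction M G "Suc n" L loss A ?p by (rule bandit)
  define \<Theta> where "\<Theta> t \<omega> = dual (a \<omega>) (y \<omega>) t" for t \<omega>
  have p_eq: "?p (Suc t) \<omega> = choice (\<Theta> t \<omega>)" for t \<omega>
    by (simp add: hedged_dist_eq \<Theta>_def)
  have loss: "0 \<le> loss s \<omega> $ i" "loss s \<omega> $ i \<le> L" if "s \<in> {1..Suc n}" "\<omega> \<in> space M" for s \<omega> i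
    using B.loss_range[OF that, of i] by auto
  obtain C where C: "\<And>a y t. (\<forall>s\<in>{1..n}. y s \<in> {0..L}) \<Longrightarrow> t \<le> n \<Longrightarrow> norm (dual a y t) \<le> C"
    using dual_bounded[of n L] by blast
  obtain \<epsilon> where \<epsilon>: "0 < \<epsilon>" "\<And>\<Theta> i. norm \<Theta> \<le> C \<Longrightarrow> \<epsilon> \<le> choice \<Theta> $ i"
    using choice_bounded_below[of C] by blast
  have low: "\<epsilon> \<le> choice (\<Theta> t \<omega>) $ i" if "t \<le> n" "\<omega> \<in> space M" for t \<omega> i
    unfolding \<Theta>_def using that loss by (intro \<epsilon> C) (auto simp: y_def)

  have sub: "subalgebra (G t) (G s)" if "s \<le> t" for s t
    using B.sets_F_mono[OF that] by (simp add: subalgebra_def B.space_F)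
  \<comment> \<open>The dual point after \<open>t\<close> rounds uses arms and losses of rounds 1 to
    \<open>t\<close>, all known before the draw of round \<open>Suc t\<close>.\<close>
  have \<Theta>_G [measurable]: "\<Theta> t \<in> borel_measurable (G (Suc t))" if "t \<le> n" for t
  proof -
    have "A s \<in> measurable (G (Suc t)) (count_space UNIV)" if "s \<in> {1..t}" for s
      using that \<open>t \<le> n\<close> by (intro measurable_from_subalg[OF sub B.arm_measurable]) auto
    moreover have "loss s \<in> borel_measurable (G (Suc t))" if "s \<in> {1..t}" for s
      using that \<open>t \<le> n\<close> by (intro measurable_from_subalg[OF sub B.loss_measurable]) auto
    moreover have "0 \<le> loss s \<omega> $ i" if "s \<in> {1..t}" "\<omega> \<in> space (G (Suc t))" for s \<omega> i
      using that \<open>t \<le> n\<close> by (intro loss) (auto simp: B.space_F)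
    ultimately show ?thesis
      using measurable_dual_bias[of t A "G (Suc t)" loss] by (simp add: \<Theta>_def[abs_def] a_def y_def)
  qed
  have \<Theta>_M: "\<Theta> t \<in> borel_measurable M" if "t \<le> n" for t
    by (rule measurable_from_subalg[OF B.subalgebra \<Theta>_G[OF that]])

  define gap where "gap t \<omega> = stab_gap (\<Theta> t \<omega>) (A (Suc t) \<omega>) (loss (Suc t) \<omega> $ A (Suc t) \<omega>)" for t \<omega>
  define est where "est t \<omega> = (if A (Suc t) \<omega> = k then loss (Suc t) \<omega> $ A (Suc t) \<omega> / choice (\<Theta> t \<omega>) $ A (Suc t) \<omega> else 0)" for t \<omega>
  have per_round:
    "integrable M (gap t) \<and> (\<integral>\<omega>. gap t \<omega> \<partial>M) \<le> \<eta> * S"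
    "integrable M (est t) \<and> (\<integral>\<omega>. est t \<omega> \<partial>M) = (\<integral>\<omega>. loss (Suc t) \<omega> $ k \<partial>M)"
    "integrable M (\<lambda>\<omega>. loss (Suc t) \<omega> $ A (Suc t) \<omega>)"
    "integrable M (\<lambda>\<omega>. loss (Suc t) \<omega> $ k)"
    if t: "t \<le> n" for t
  proof -
    have T: "Suc t \<in> {1..Suc n}" using t by auto
    note [measurable] = \<Theta>_G[OF t] B.loss_measurable[OF T]
    have pm: "(\<lambda>\<omega>. ?p (Suc t) \<omega> $ i) \<in> borel_measurable (G (Suc t))" for i
      unfolding p_eq by measurable
    have bound: "\<bar>stab_gap (\<Theta> t \<omega>) i (loss (Suc t) \<omega> $ i)\<bar> \<le> L / \<epsilon> + L" if "\<omega> \<in> space M" for i \<omega>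
      using that loss[OF T that, of i] low[OF t that, of i] \<epsilon>(1) by (intro stab_gap_bounded) auto
    then have bound': "\<forall>\<omega>\<in>space M. \<bar>stab_gap (\<Theta> t \<omega>) i (loss (Suc t) \<omega> $ i)\<bar> \<le> L / \<epsilon> + L" for i
      by blast
    have gm: "(\<lambda>\<omega>. stab_gap (\<Theta> t \<omega>) i (loss (Suc t) \<omega> $ i)) \<in> borel_measurable (G (Suc t))" for i
      unfolding stab_gap_def by measurable
    note gap = B.integral_at_arm[of "Suc t" "\<lambda>i \<omega>. stab_gap (\<Theta> t \<omega>) i (loss (Suc t) \<omega> $ i)", OF T gm bound' pm]
    have "(\<integral>\<omega>. (\<Sum>i\<in>UNIV. ?p (Suc t) \<omega> $ i * stab_gap (\<Theta> t \<omega>) i (loss (Suc t) \<omega> $ i)) \<partial>M) \<le> (\<integral>\<omega>. \<eta> * S \<partial>M)"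
    proof (rule integral_mono[OF gap(2)])
      fix \<omega> assume "\<omega> \<in> space M"
      then show "(\<Sum>i\<in>UNIV. ?p (Suc t) \<omega> $ i * stab_gap (\<Theta> t \<omega>) i (loss (Suc t) \<omega> $ i)) \<le> \<eta> * S"
        unfolding p_eq stab_gap_def using loss[OF T] by (intro stab_step_le[OF stab]) auto
    qed (rule B.integrable_const)
    then show "integrable M (gap t) \<and> (\<integral>\<omega>. gap t \<omega> \<partial>M) \<le> \<eta> * S"
      using gap(1,3) by (simp add: gap_def[abs_def] B.prob_space)

    have em: "(\<lambda>\<omega>. if i = k then loss (Suc t) \<omega> $ i / choice (\<Theta> t \<omega>) $ i else 0) \<in> borel_measurable (G (Suc t))" for i
      by measurable
    have eb: "\<forall>\<omega>\<in>space M. \<bar>if i = k then loss (Suc t) \<omega> $ i / choice (\<Theta> t \<omega>) $ i else 0\<bar> \<le> \<bar>L\<bar> / \<epsilon>" for i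
    proof
      fix \<omega> assume \<omega>: "\<omega> \<in> space M"
      show "\<bar>if i = k then loss (Suc t) \<omega> $ i / choice (\<Theta> t \<omega>) $ i else 0\<bar> \<le> \<bar>L\<bar> / \<epsilon>"
        using loss[OF T \<omega>, of i] low[OF t \<omega>, of i] \<epsilon>(1) by (auto intro!: frac_le)
    qed
    note est = B.integral_at_arm[of "Suc t" "\<lambda>i \<omega>. if i = k then loss (Suc t) \<omega> $ i / choice (\<Theta> t \<omega>) $ i else 0", OF T em eb pm]
    \<comment> \<open>Unbiasedness of the estimator: the weight of arm \<open>k\<close> cancels its
      probability.\<close>
    have "(\<Sum>i\<in>UNIV. ?p (Suc t) \<omega> $ i * (if i = k then loss (Suc t) \<omega> $ i / choice (\<Theta> t \<omega>) $ i else 0)) = loss (Suc t) \<omega> $ k" for \<omega>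
    proof -
      have "(\<Sum>i\<in>UNIV. ?p (Suc t) \<omega> $ i * (if i = k then loss (Suc t) \<omega> $ i / choice (\<Theta> t \<omega>) $ i else 0)) =
          (\<Sum>i\<in>UNIV. if i = k then loss (Suc t) \<omega> $ i else 0)"
        using choice_pos[of "\<Theta> t \<omega>"] by (intro sum.cong) (auto simp: p_eq less_imp_neq[symmetric])
      then show ?thesis by simp
    qed
    with est show "integrable M (est t) \<and> (\<integral>\<omega>. est t \<omega> \<partial>M) = (\<integral>\<omega>. loss (Suc t) \<omega> $ k \<partial>M)"
      "integrable M (\<lambda>\<omega>. loss (Suc t) \<omega> $ k)"
      by (simp_all add: est_def[abs_def])
    have lm: "(\<lambda>\<omega>. loss (Suc t) \<omega> $ i) \<in> borel_measurable (G (Suc t))" for i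
      by measurable
    show "integrable M (\<lambda>\<omega>. loss (Suc t) \<omega> $ A (Suc t) \<omega>)"
      using loss[OF T] by (intro B.integral_at_arm(1)[OF T lm _ pm, where K = L]) auto
  qed

  have peak_M [measurable]: "(\<lambda>\<omega>. peak (a \<omega>) (y \<omega>) (Suc t) i) \<in> borel_measurable M" if "t \<le> n" for t i
    using that
  proof (induction t)
    case 0
    show ?case by (simp add: peak_1)
  next
    case (Suc t)
    have [measurable]: "(\<lambda>\<omega>. peak (a \<omega>) (y \<omega>) (Suc t) i) \<in> borel_measurable M" "\<Theta> (Suc t) \<in> borel_measurable M"
      using Suc \<Theta>_M[OF Suc.prems] by auto
    show ?case
      unfolding peak_Suc \<Theta>_def[symmetric] by measurable
  qed
  have init_pos: "0 < init_rho F i" for i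
    by (simp add: init_rho_def init_dist_eq_choice choice_pos)
  have peak_range: "init_rho F i \<le> peak (a \<omega>) (y \<omega>) (Suc n) i" "peak (a \<omega>) (y \<omega>) (Suc n) i \<le> inverse \<epsilon>"
    if "\<omega> \<in> space M" for i \<omega>
    using that low \<epsilon>(1) by (auto intro!: peak_bounds simp flip: \<Theta>_def)
  have int_peak: "integrable M (\<lambda>\<omega>. peak (a \<omega>) (y \<omega>) (Suc n) i powr (\<alpha> - 1))"
    "integrable M (\<lambda>\<omega>. peak (a \<omega>) (y \<omega>) (Suc n) i powr \<alpha>)" for i
  proof -
    show "integrable M (\<lambda>\<omega>. peak (a \<omega>) (y \<omega>) (Suc n) i powr (\<alpha> - 1))"
      using peak_M[of n i] exponent init_pos[of i] peak_range(1)[of _ i]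
      by (intro B.integrable_const_bound[where B = "init_rho F i powr (\<alpha> - 1)"])
         (auto intro!: AE_I2 powr_mono2')
    show "integrable M (\<lambda>\<omega>. peak (a \<omega>) (y \<omega>) (Suc n) i powr \<alpha>)"
      using peak_M[of n i] exponent peak_pos peak_range(2)[of _ i]
      by (intro B.integrable_const_bound[where B = "inverse \<epsilon> powr \<alpha>"])
         (auto intro!: AE_I2 powr_mono2 simp: less_imp_le)
  qed

  have cum: "cum_loss (a \<omega>) (y \<omega>) (Suc n) $ k = (\<Sum>t<Suc n. est t \<omega>)" for \<omega>
    unfolding cum_loss_eq_sum est_def loss_estimate_def by (auto simp: a_def y_def \<Theta>_def intro!: sum.cong)
  let ?B = "\<lambda>\<omega>. D / \<eta> + (\<Sum>t<Suc n. gap t \<omega>) +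
    (\<alpha> / (1 - \<alpha>) * (\<Sum>i\<in>UNIV. init_rho F i powr (\<alpha> - 1) - peak (a \<omega>) (y \<omega>) (Suc n) i powr (\<alpha> - 1)) +
      init_rho F k powr \<alpha> - peak (a \<omega>) (y \<omega>) (Suc n) k powr \<alpha>) * R"
  have bound: "(\<Sum>t<Suc n. loss (Suc t) \<omega> $ A (Suc t) \<omega> - est t \<omega>) \<le> ?B \<omega>" if "\<omega> \<in> space M" for \<omega>
  proof -
    have "0 \<le> y \<omega> s" if "s \<in> {1..n}" for s
      using that \<open>\<omega> \<in> space M\<close> by (auto simp: y_def intro!: loss)
    from pathwise_regret[of n "y \<omega>" k D "a \<omega>", OF this diam]
    show ?thesis
      by (simp only: cum sum_subtractf) (simp only: a_def y_def gap_def \<Theta>_def)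
  qed
  have const: "has_bochner_integral M (\<lambda>_. r) r" for r :: real
    by (simp add: has_bochner_integral_iff B.prob_space)
  have "integrable M (gap t)" if "t \<in> {..<Suc n}" for t
    using per_round(1)[of t] that by auto
  then have B_int: "has_bochner_integral M ?B (
    D / \<eta> + (\<Sum>t<Suc n. \<integral>\<omega>. gap t \<omega> \<partial>M) +
    (\<alpha> / (1 - \<alpha>) * (\<Sum>i\<in>UNIV. init_rho F i powr (\<alpha> - 1) -
        (\<integral>\<omega>. peak (a \<omega>) (y \<omega>) (Suc n) i powr (\<alpha> - 1) \<partial>M)) +
      init_rho F k powr \<alpha> - (\<integral>\<omega>. peak (a \<omega>) (y \<omega>) (Suc n) k powr \<alpha> \<partial>M)) * R)"
    by (intro has_bochner_integral_add has_bochner_integral_diff has_bochner_integral_mult_left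
        has_bochner_integral_mult_right has_bochner_integral_sum const
        has_bochner_integral_integrable int_peak)
  \<comment> \<open>Only expectations agree here, so the comparator loss is exchanged for its
    estimate round by round before the pathwise bound is used.\<close>
  have exp_diff: "(\<integral>\<omega>. loss (Suc t) \<omega> $ A (Suc t) \<omega> - loss (Suc t) \<omega> $ k \<partial>M) =
      (\<integral>\<omega>. loss (Suc t) \<omega> $ A (Suc t) \<omega> - est t \<omega> \<partial>M)" if "t < Suc n" for t
    using per_round[of t] that by simp
  have "(\<integral>\<omega>. (\<Sum>t\<in>{1..Suc n}. loss t \<omega> $ A t \<omega> - loss t \<omega> $ k) \<partial>M) =
      (\<Sum>t<Suc n. \<integral>\<omega>. loss (Suc t) \<omega> $ A (Suc t) \<omega> - loss (Suc t) \<omega> $ k \<partial>M)"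
    unfolding One_nat_def sum.atLeast1_atMost_eq
    by (rule Bochner_Integration.integral_sum)
       (intro Bochner_Integration.integrable_diff per_round; simp)
  also have "\<dots> = (\<Sum>t<Suc n. \<integral>\<omega>. loss (Suc t) \<omega> $ A (Suc t) \<omega> - est t \<omega> \<partial>M)"
    by (rule sum.cong[OF refl exp_diff]) simp
  also have "\<dots> = (\<integral>\<omega>. (\<Sum>t<Suc n. loss (Suc t) \<omega> $ A (Suc t) \<omega> - est t \<omega>) \<partial>M)"
    by (rule Bochner_Integration.integral_sum[symmetric])
       (use per_round in \<open>auto simp: less_Suc_eq_le\<close>)
  also have "\<dots> \<le> (\<integral>\<omega>. ?B \<omega> \<partial>M)"
  proof (rule integral_mono)
    show "integrable M (\<lambda>\<omega>. \<Sum>t<Suc n. loss (Suc t) \<omega> $ A (Suc t) \<omega> - est t \<omega>)"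
      using per_round by (auto intro!: Bochner_Integration.integrable_sum simp: less_Suc_eq_le)
    show "integrable M ?B" using B_int by (rule integrable.intros)
  qed (rule bound)
  also have "\<dots> = D / \<eta> + (\<Sum>t<Suc n. \<integral>\<omega>. gap t \<omega> \<partial>M) +
    (\<alpha> / (1 - \<alpha>) * (\<Sum>i\<in>UNIV. init_rho F i powr (\<alpha> - 1) -
        (\<integral>\<omega>. peak (a \<omega>) (y \<omega>) (Suc n) i powr (\<alpha> - 1) \<partial>M)) +
      init_rho F k powr \<alpha> - (\<integral>\<omega>. peak (a \<omega>) (y \<omega>) (Suc n) k powr \<alpha> \<partial>M)) * R"
    using B_int by (rule has_bochner_integral_integral_eq)
  also have "(\<Sum>t<Suc n. \<integral>\<omega>. gap t \<omega> \<partial>M) \<le> (\<Sum>t<Suc n. \<eta> * S)"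
    using per_round(1) by (intro sum_mono) auto
  finally show ?thesis by simp
qed

end

section \<open>The diameter bound and the choice of the learning rate\<close>

lemma potential_diam_ge:
  assumes "potential_diam F < \<infinity>" "p \<in> prob_simplex" "q \<in> prob_simplex"
  shows "F p - F q \<le> real_of_ereal (potential_diam F)"
proof -
  let ?s = "SUP p\<in>prob_simplex. ereal (F p)" and ?i = "INF p\<in>prob_simplex. ereal (F p)"
  have "ereal (F p) \<le> ?s" "?i \<le> ereal (F q)"
    using assms(2,3) by (auto intro: SUP_upper INF_lower)
  moreover have "?s - ?i < \<infinity>" using assms(1) by (simp add: potential_diam_def)
  ultimately show ?thesis
    unfolding potential_diam_def by (cases ?s; cases ?i) auto
qed

theorem theorem6:
  fixes c :: "real ^ 'n" and f :: "real \<Rightarrow> real" and \<alpha> R L :: real and T :: nat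
    and M :: "'w measure" and G :: "nat \<Rightarrow> 'w measure"
    and loss :: "nat \<Rightarrow> 'w \<Rightarrow> real ^ 'n" and A :: "nat \<Rightarrow> 'w \<Rightarrow> 'n" and a :: 'n
  defines "F \<equiv> separable_potential c f"
  defines "S \<equiv> real_of_ereal (stab L F)"
  defines "D \<equiv> real_of_ereal (potential_diam F)"
  defines "\<eta> \<equiv> sqrt (D / (S * real T))"
  defines "p \<equiv> (\<lambda>t \<omega>. hedged_dist \<eta> F \<alpha> R (\<lambda>s. A s \<omega>) (\<lambda>s. loss s \<omega> $ A s \<omega>) t)"
  defines "\<rho> \<equiv> (\<lambda>t \<omega> i. MAX s\<in>{1..t}. inverse (p s \<omega> $ i))"
  assumes "\<And>i. 0 < c $ i" and "legendre_function f"
    and "stab L F < \<infinity>" and "potential_diam F < \<infinity>"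
    and "0 < \<alpha>" and "\<alpha> < 1" and "0 < R"
    and "0 < \<eta>"
    and "bandit_interaction M G T L loss A p"
  shows "(\<integral>\<omega>. (\<Sum>t\<in>{1..T}. loss t \<omega> $ A t \<omega> - loss t \<omega> $ a) \<partial>M)
    \<le> 2 * sqrt (S * D * real T)
      + (\<alpha> / (1 - \<alpha>) * (\<Sum>i\<in>UNIV. init_rho F i powr (\<alpha> - 1) - (\<integral>\<omega>. \<rho> T \<omega> i powr (\<alpha> - 1) \<partial>M))
         + init_rho F a powr \<alpha> - (\<integral>\<omega>. \<rho> T \<omega> a powr \<alpha> \<partial>M)) * R"
proof -
  interpret hedged_ftrl c f \<eta> \<alpha> R
    using assms(7-14) by unfold_locales auto
  have F_eq: "F = separable_potential c f" by (simp add: F_def)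
  have diam: "F q - F r \<le> D" if "q \<in> prob_simplex" "r \<in> prob_simplex" for q r
    unfolding D_def using potential_diam_ge[OF assms(10) that] .
  have "0 \<le> D" using diam[OF choice_in choice_in, of 0 0] by simp
  \<comment> \<open>Division by zero yields 0, so a positive learning rate excludes a vanishing
    \<open>S\<close> or \<open>T\<close>; as \<open>D\<close> is nonnegative, \<open>D\<close>,
    \<open>S\<close> and \<open>T\<close> are all positive.\<close>
  moreover have "0 < D / (S * real T)" using \<open>0 < \<eta>\<close> by (simp add: \<eta>_def)
  ultimately have "0 < D" "0 < S * real T" by (auto simp: zero_less_divide_iff)
  then have S: "0 < S" "T \<noteq> 0" by (auto simp: zero_less_mult_iff)
  then obtain n where T: "T = Suc n" by (cases T) auto
  \<comment> \<open>\<open>real_of_ereal\<close> sends infinite values to 0, so positivity of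
    \<open>S\<close> also excludes minus infinity.\<close>
  have stab: "stab L F = ereal S"
    using S(1) assms(9) unfolding S_def by (cases "stab L F") auto
  have sq: "\<eta> * \<eta> = D / (S * real T)"
    using \<open>0 < D / (S * real T)\<close> by (simp only: \<eta>_def real_sqrt_mult_self abs_of_pos)
  \<comment> \<open>The learning rate balances the diameter term against the stability term, which
    gives the factor 2.\<close>
  have 1: "D / \<eta> = real T * (\<eta> * S)"
    using sq \<open>0 < \<eta>\<close> S by (simp add: field_simps)
  have "sqrt (S * D * real T) = real T * (\<eta> * S)"
  proof (rule real_sqrt_unique)
    have "(real T * (\<eta> * S))\<^sup>2 = (\<eta> * \<eta>) * (real T * S)\<^sup>2"
      by (simp add: power2_eq_square mult_ac)
    also have "\<dots> = S * D * real T"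
      unfolding sq using S by (simp add: power2_eq_square)
    finally show "(real T * (\<eta> * S))\<^sup>2 = S * D * real T" .
  qed (use S \<open>0 < \<eta>\<close> in simp)
  with 1 have rate: "D / \<eta> + real T * (\<eta> * S) = 2 * sqrt (S * D * real T)" by simp
  have "F (axis a 1) - F (init_dist F) \<le> D"
    using diam[OF axis_in_prob_simplex choice_in] by (simp add: F_eq init_dist_eq_choice)
  from expected_regret[of M G n L loss A S a D] stab this assms(15)
  show ?thesis
    unfolding T[symmetric] F_eq[symmetric] rate peak_def \<rho>_def p_def by simp
qed

end
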